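(* There is a randomized algorithm for the 0-1 knapsack problem that runs in $\widetilde{O}(n^{3/2}w_{\max})$ time and outputs the optimal value $\mathrm{OPT}$ correctly with high probability.
   Context: In the 0-1 knapsack problem, the input is a capacity $W\in\mathbb{Z}^+$ and $n$ items $(w_1,p_1),\dots,(w_n,p_n)$ with weights $w_i\in\mathbb{Z}^+$ and profits $p_i\in\mathbb{Z}^+$. The goal is to compute $\mathrm{OPT}=\max\{\sum_{i\in S}p_i : S\subseteq\{1,\dots,n\},\ \sum_{i\in S}w_i\le W\}$. Here $w_{\max}=\max_i w_i$. The notation $\widetilde{O}(\cdot)$ hides polylogarithmic factors, and "with high probability" means with probability at least $1-1/\mathrm{poly}(n)$. *)

theory Defs
  imports Complex_Main
begin

definition valid_instance :: "nat \<Rightarrow> (nat \<times> nat) list \<Rightarrow> bool" where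
  "valid_instance W items \<longleftrightarrow> W > 0 \<and> items \<noteq> [] \<and>
     (\<forall>(w, p) \<in> set items. w > 0 \<and> p > 0)"

definition knapsack_opt :: "nat \<Rightarrow> (nat \<times> nat) list \<Rightarrow> nat" where
  "knapsack_opt W items =
     Max {(\<Sum>i\<in>S. snd (items ! i)) | S. S \<subseteq> {..<length items} \<and>
                                          (\<Sum>i\<in>S. fst (items ! i)) \<le> W}"

definition wmax :: "(nat \<times> nat) list \<Rightarrow> nat" where
  "wmax items = Max (fst ` set items)"

text \<open>Memory is a map from integer addresses to integer words. Instruction
  operands are (constant) memory addresses; Load/Store are indirect.
  Every written value and every indirect address must fit into the word
  size b (absolute value below 2^b), otherwise the machine errs.
  Rand writes a fresh uniformly random bit; the machine reads coin t at step t.\<close>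

datatype instr =
    Const int int
  | Add int int int
  | Sub int int int
  | Mul int int int
  | Div int int int
  | Load int int
  | Store int int
  | Jz int nat
  | Jneg int nat
  | Rand int
  | Halt

datatype config = Run nat "int \<Rightarrow> int" | Done int | Err

definition fits :: "nat \<Rightarrow> int \<Rightarrow> bool" where
  "fits b v \<longleftrightarrow> \<bar>v\<bar> < 2 ^ b"

definition upd :: "nat \<Rightarrow> (int \<Rightarrow> int) \<Rightarrow> int \<Rightarrow> int \<Rightarrow> nat \<Rightarrow> config" where
  "upd b M a v pc = (if fits b a \<and> fits b v then Run (Suc pc) (M(a := v)) else Err)"

fun step :: "instr list \<Rightarrow> nat \<Rightarrow> config \<Rightarrow> bool \<Rightarrow> config" where
  "step P b Err c = Err"
| "step P b (Done x) c = Done x"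
| "step P b (Run pc M) c =
    (if length P \<le> pc then Err else
     (case P ! pc of
        Const r k \<Rightarrow> upd b M r k pc
      | Add r x y \<Rightarrow> upd b M r (M x + M y) pc
      | Sub r x y \<Rightarrow> upd b M r (M x - M y) pc
      | Mul r x y \<Rightarrow> upd b M r (M x * M y) pc
      | Div r x y \<Rightarrow> upd b M r (M x div M y) pc
      | Load r a \<Rightarrow> (if fits b (M a) then upd b M r (M (M a)) pc else Err)
      | Store a x \<Rightarrow> upd b M (M a) (M x) pc
      | Jz x t \<Rightarrow> (if M x = 0 then Run t M else Run (Suc pc) M)
      | Jneg x t \<Rightarrow> (if M x < 0 then Run t M else Run (Suc pc) M)
      | Rand r \<Rightarrow> upd b M r (if c then 1 else 0) pc
      | Halt \<Rightarrow> Done (M 0)))"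

definition init_mem :: "nat \<Rightarrow> (nat \<times> nat) list \<Rightarrow> int \<Rightarrow> int" where
  "init_mem W items a =
     (if a = 0 then int (length items)
      else if a = 1 then int W
      else if 2 \<le> a \<and> a < 2 + 2 * int (length items) then
        (if even a then int (fst (items ! nat ((a - 2) div 2)))
         else int (snd (items ! nat ((a - 2) div 2))))
      else 0)"

definition exec :: "instr list \<Rightarrow> nat \<Rightarrow> nat \<Rightarrow> (nat \<times> nat) list \<Rightarrow> bool list \<Rightarrow> config" where
  "exec P b W items cs = foldl (step P b) (Run 0 (init_mem W items)) cs"

definition word_size :: "nat \<Rightarrow> nat \<Rightarrow> (nat \<times> nat) list \<Rightarrow> nat" where
  "word_size cw W items =
     cw * nat \<lceil>log 2 (real (length items + W + (\<Sum>(w,p)\<leftarrow>items. w + p) + 2))\<rceil>"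

end

theory Submission
  imports Defs
begin

text \<open>
  Give every item an independent uniform key below \<open>K\<close>, a power of two of order \<open>sqrt n\<close>, and run
  the textbook dynamic program over the items in the order of their keys. For a fixed optimal set
  \<open>S\<close> the weight of the items of \<open>S\<close> with keys below \<open>q\<close> is a sum of independent variables
  with mean \<open>q * w(S) / K\<close>, so by an exponential moment bound it deviates from its mean by at most
  \<open>O(wmax * sqrt n * log n)\<close> for all \<open>q\<close> at once, except with probability \<open>1 / (n + 1)\<close>. Hence it
  suffices to update, while items with key \<open>q\<close> are treated, the table entries in a window of this
  size around \<open>q * W / K\<close>, after \<open>W\<close> has been replaced by the total weight if that is smaller: then
  an optimal set leaves less than \<open>wmax\<close> of the capacity unused. Entries outside the window are
  merely out of date; they still are profits of feasible sets, so the output never exceeds the optimum.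
\<close>

section \<open>Uniform coins and exponential moments\<close>

text \<open>\<open>K\<close> of order sqrt n balances two terms: within one phase the mean moves by
  \<open>cap / K\<close>, which is at most \<open>wm * n / K\<close>, while the deviation is of
  order \<open>wm * sqrt n\<close> up to a logarithm. An item pays for one window only, in the phase
  of its key; looking at all keys in every phase costs \<open>O(n * K)\<close> and replaces sorting.
  Independent keys, unlike a random permutation, make the exponential moment of a weight factor over
  the items. A power of two makes the keys exactly uniform, since the machine draws bits.

  The machine consumes a coin in every step, whether or not it draws, so the coins that form the
  keys have to be located exactly. The setup takes a number of steps that depends on the instance
  but not on the coins, and each key takes a fixed number of steps. After the keys no coin is drawn,
  and an upper bound on the steps is enough. Probabilities are plain counts of coin strings.\<close>

lemma finite_coins: "finite {cs :: bool list. length cs = n}"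
  using finite_lists_length_eq[of "UNIV :: bool set" n] by simp

lemma card_coins: "card {cs :: bool list. length cs = n} = 2 ^ n"
  using card_lists_length_eq[of "UNIV :: bool set" n] by simp

text \<open>Sums over all coin strings of a fixed length serve as unnormalised expectations; this is
  Fubini for them.\<close>

lemma sum_coins_add:
  fixes f :: "bool list \<Rightarrow> 'a :: comm_monoid_add"
  shows "(\<Sum>cs | length cs = a + b. f cs) = (\<Sum>x | length x = a. \<Sum>y | length y = b. f (x @ y))"
proof -
  have "(\<Sum>x | length x = a. \<Sum>y | length y = b. f (x @ y)) =
      (\<Sum>(x, y) \<in> {x. length x = a} \<times> {y. length y = b}. f (x @ y))"
    by (simp add: sum.cartesian_product)
  also have "\<dots> = (\<Sum>cs | length cs = a + b. f cs)"
    by (rule sum.reindex_bij_witness[of _ "\<lambda>cs. (take a cs, drop a cs)" "\<lambda>(x, y). x @ y"]) auto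
  finally show ?thesis by simp
qed

lemma sum_coins_Suc:
  fixes f :: "bool list \<Rightarrow> 'a :: comm_monoid_add"
  shows "(\<Sum>cs | length cs = Suc n. f cs) = (\<Sum>cs | length cs = n. f (True # cs)) + (\<Sum>cs | length cs = n. f (False # cs))"
proof -
  have "{cs :: bool list. length cs = Suc 0} = {[True], [False]}"
    by (auto simp: length_Suc_conv)
  then show ?thesis
    using sum_coins_add[of f "Suc 0" n] by simp
qed

lemma sum_lessThan_add:
  fixes g :: "nat \<Rightarrow> 'a :: comm_monoid_add"
  shows "(\<Sum>v<a + b. g v) = (\<Sum>v<a. g v) + (\<Sum>v<b. g (a + v))"
  by (induction b) (simp_all add: add.assoc)

text \<open>One round of the bit loop of the program below takes six steps, of which the second one reads
  its coin; this fixes which of the coins enter the key. Likewise a block of \<^term>\<open>6 * m + 8\<close> coins,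
  three of them spent before the bit loop and five after it, produces the key of one item.\<close>

fun read_key :: "nat \<Rightarrow> bool list \<Rightarrow> nat \<Rightarrow> nat" where
  "read_key 0 x acc = acc"
| "read_key (Suc m) x acc = read_key m (drop 6 x) (2 * acc + of_bool (x ! 1))"

lemma read_key_less: "read_key m x acc < (acc + 1) * 2 ^ m"
proof (induction m arbitrary: x acc)
  case (Suc m)
  have "read_key (Suc m) x acc < (2 * acc + of_bool (x ! 1) + 1) * 2 ^ m"
    using Suc.IH by simp
  also have "\<dots> \<le> (2 * acc + 2) * 2 ^ m"
    by (intro mult_right_mono) auto
  finally show ?case by (simp add: algebra_simps)
qed simp

text \<open>The five ignored coins of a round give the factor 32, and the one that is read halves
  the range. Bits enter from the top, so the prefix \<open>acc\<close> leads to the values of an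
  interval of length \<open>2 ^ m\<close> starting at \<open>acc * 2 ^ m\<close>, each equally
  often.\<close>

lemma sum_read_key:
  fixes h :: "nat \<Rightarrow> real"
  shows "(\<Sum>x | length x = 6 * m. h (read_key m x acc)) = 32 ^ m * (\<Sum>v<2 ^ m. h (acc * 2 ^ m + v))"
proof (induction m arbitrary: acc)
  case (Suc m)
  let ?s = "\<lambda>acc. \<Sum>x | length x = 6 * m. h (read_key m x acc)"
  have six: "6 * Suc m = Suc (Suc (Suc (Suc (Suc (Suc (6 * m))))))" by simp
  have "(\<Sum>x | length x = 6 * Suc m. h (read_key (Suc m) x acc)) = 32 * (?s (2 * acc) + ?s (2 * acc + 1))"
    unfolding six by (simp only: sum_coins_Suc) (simp add: eval_nat_numeral)
  also have "\<dots> = 32 ^ Suc m * ((\<Sum>v<2 ^ m. h (2 * acc * 2 ^ m + v)) + (\<Sum>v<2 ^ m. h (2 * acc * 2 ^ m + (2 ^ m + v))))"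
    unfolding Suc.IH by (simp add: algebra_simps)
  also have "(\<Sum>v<2 ^ m. h (2 * acc * 2 ^ m + v)) + (\<Sum>v<2 ^ m. h (2 * acc * 2 ^ m + (2 ^ m + v)))
      = (\<Sum>v<2 ^ m + 2 ^ m. h (2 * acc * 2 ^ m + v))"
    by (rule sum_lessThan_add[symmetric])
  finally show ?case by (simp add: algebra_simps flip: mult_2[of "2 ^ m :: nat"])
qed simp

definition block_key :: "nat \<Rightarrow> bool list \<Rightarrow> nat" where
  "block_key m x = read_key m (drop 3 (take (6 * m + 3) x)) 0"

text \<open>The eight coins around the bit loop contribute \<open>2 ^ 8\<close>, the ignored ones
  inside it \<open>2 ^ (5 * m)\<close>; hence a key is exactly uniform below
  \<open>2 ^ m\<close>.\<close>

lemma sum_block_key: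
  fixes h :: "nat \<Rightarrow> real"
  shows "(\<Sum>x | length x = 6 * m + 8. h (block_key m x)) = 2 ^ (5 * m + 8) * (\<Sum>v<2 ^ m. h v)"
proof -
  have eq: "6 * m + 8 = 3 + (6 * m + 5)" by simp
  have inner: "(\<Sum>y | length y = 6 * m + 5. h (block_key m (x @ y))) = 32 * (32 ^ m * (\<Sum>v<2 ^ m. h v))"
    if "length x = 3" for x
  proof -
    have "(\<Sum>z | length z = 5. h (block_key m (x @ y @ z))) = 32 * h (read_key m y 0)" if "length y = 6 * m" for y
      using that \<open>length x = 3\<close> by (simp add: block_key_def card_coins)
    then have "(\<Sum>y | length y = 6 * m + 5. h (block_key m (x @ y))) = (\<Sum>y | length y = 6 * m. 32 * h (read_key m y 0))"
      unfolding sum_coins_add by simp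
    also have "\<dots> = 32 * (32 ^ m * (\<Sum>v<2 ^ m. h v))"
      using sum_read_key[where acc = 0 and m = m and h = h] by (simp flip: sum_distrib_left)
    finally show ?thesis .
  qed
  have "(\<Sum>x | length x = 6 * m + 8. h (block_key m x)) = 8 * (32 * (32 ^ m * (\<Sum>v<2 ^ m. h v)))"
    unfolding eq sum_coins_add[where a = 3] using inner by (simp add: card_coins)
  then show ?thesis by (simp add: power_add power_mult)
qed

text \<open>The first block goes to the highest index because the key loop of the program counts
  down. The default \<open>0\<close> makes \<open>keys_less\<close> true for every index.\<close>

primrec keys :: "nat \<Rightarrow> nat \<Rightarrow> bool list \<Rightarrow> nat \<Rightarrow> nat" where
  "keys m 0 cs = (\<lambda>_. 0)"
| "keys m (Suc n) cs = (keys m n (drop (6 * m + 8) cs))(n := block_key m (take (6 * m + 8) cs))"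

lemma keys_less: "keys m n cs i < 2 ^ m"
  by (induction n arbitrary: cs) (use read_key_less[where acc = 0] in \<open>auto simp: block_key_def\<close>)

text \<open>Disjoint blocks of coins produce the keys; this is their independence, in the form that
  the exponential moment uses.\<close>

lemma sum_prod_keys:
  fixes h :: "nat \<Rightarrow> nat \<Rightarrow> real"
  shows "(\<Sum>cs | length cs = n * (6 * m + 8). \<Prod>i<n. h i (keys m n cs i)) =
    (\<Prod>i<n. 2 ^ (5 * m + 8) * (\<Sum>v<2 ^ m. h i v))"
proof (induction n)
  case (Suc n)
  have "(\<Sum>cs | length cs = Suc n * (6 * m + 8). \<Prod>i<Suc n. h i (keys m (Suc n) cs i)) =
    (\<Sum>x | length x = 6 * m + 8. \<Sum>y | length y = n * (6 * m + 8). (\<Prod>i<n. h i (keys m n y i)) * h n (block_key m x))"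
    unfolding mult_Suc sum_coins_add by (intro sum.cong refl) (simp add: prod.lessThan_Suc)
  also have "\<dots> = (\<Prod>i<n. 2 ^ (5 * m + 8) * (\<Sum>v<2 ^ m. h i v)) * (\<Sum>x | length x = 6 * m + 8. h n (block_key m x))"
    by (simp add: Suc.IH flip: sum_distrib_left sum_distrib_right)
  finally show ?case by (simp add: sum_block_key)
qed simp

section \<open>A Chernoff bound for weighted sums of key indicators\<close>

lemma exp_le_quadratic:
  fixes y :: real
  assumes "\<bar>y\<bar> \<le> 1"
  shows "exp y \<le> 1 + y + y\<^sup>2"
proof (cases "y \<ge> 0")
  case True
  then show ?thesis using assms exp_bound by auto
next
  case False
  \<comment> \<open>For negative \<open>y\<close> the claim is multiplied by
    \<open>exp (- y)\<close>, which is then replaced by its lower quadratic Taylor bound; the linear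
    terms of the product cancel.\<close>
  have "1 \<le> (1 - y + y\<^sup>2 / 2) * (1 + y + y\<^sup>2)"
  proof -
    have "(1 - y + y\<^sup>2 / 2) * (1 + y + y\<^sup>2) = 1 + y\<^sup>2 / 2 * (1 - y + y\<^sup>2)"
      by (simp add: field_simps power2_eq_square)
    moreover have "0 \<le> y\<^sup>2 / 2 * (1 - y + y\<^sup>2)" using False by (intro mult_nonneg_nonneg) auto
    ultimately show ?thesis by linarith
  qed
  also have "\<dots> \<le> exp (- y) * (1 + y + y\<^sup>2)"
  proof (rule mult_right_mono)
    show "1 - y + y\<^sup>2 / 2 \<le> exp (- y)"
      using exp_lower_Taylor_quadratic[of "- y"] False by simp
    show "0 \<le> 1 + y + y\<^sup>2" using assms by (auto simp: abs_le_iff intro: add_nonneg_nonneg)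
  qed
  finally show ?thesis by (simp add: exp_minus field_simps)
qed

text \<open>\<open>q / K\<close> is the mean of the indicator for uniform \<open>v\<close>, so the
  linear terms sum to zero. The second order leaves a factor \<open>exp (1 / K^2)\<close> per
  variable, so up to \<open>K^2\<close> variables cost only a constant factor.\<close>

lemma mgf_centered_indicator:
  fixes c :: real and q K :: nat
  assumes c: "\<bar>c\<bar> \<le> 1 / real K" and K: "K \<ge> 1" and q: "q \<le> K"
  shows "(\<Sum>v<K. exp (c * (of_bool (v < q) - real q / real K))) \<le> real K * exp (1 / (real K)\<^sup>2)"
proof -
  define y where "y v = c * (of_bool (v < q) - real q / real K)" for v
  have y_abs: "\<bar>y v\<bar> \<le> 1 / real K" for v
  proof -
    have "\<bar>of_bool (v < q) - real q / real K\<bar> \<le> 1" using q K by (auto simp: abs_le_iff field_simps)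
    then have "\<bar>y v\<bar> \<le> \<bar>c\<bar> * 1" unfolding y_def abs_mult by (intro mult_left_mono) auto
    then show ?thesis using c by simp
  qed
  have "{..<K} \<inter> {v. v < q} = {..<q}" using q by auto
  then have "(\<Sum>v<K. of_bool (v < q) - real q / real K) = 0"
    using K by (simp add: sum_subtractf sum.If_cases of_bool_def)
  then have y_sum: "(\<Sum>v<K. y v) = 0" by (simp add: y_def flip: sum_distrib_left)
  have "exp (y v) \<le> 1 + y v + (1 / real K)\<^sup>2" for v
  proof -
    have "(1::real) / real K \<le> 1" using K by simp
    then have "exp (y v) \<le> 1 + y v + (y v)\<^sup>2" using y_abs[of v] by (intro exp_le_quadratic) linarith
    also have "(y v)\<^sup>2 \<le> (1 / real K)\<^sup>2" using y_abs[of v] by (rule power2_le_iff_abs_le[THEN iffD2, rotated]) simp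
    finally show ?thesis by simp
  qed
  then have "(\<Sum>v<K. exp (y v)) \<le> (\<Sum>v<K. 1 + y v + (1 / real K)\<^sup>2)" by (intro sum_mono)
  also have "\<dots> = real K * (1 + 1 / (real K)\<^sup>2)" by (simp add: sum.distrib y_sum algebra_simps power_divide)
  also have "\<dots> \<le> real K * exp (1 / (real K)\<^sup>2)" by (intro mult_left_mono exp_ge_add_one_self) auto
  finally show ?thesis by (simp add: y_def)
qed

text \<open>Markov's inequality for the exponential of the sum, with the scale of the exponent
  absorbed in \<open>c\<close>; the factors from \<open>mgf_centered_indicator\<close> multiply to
  at most \<open>exp 1\<close>. Lower tails are obtained by changing the sign of
  \<open>c\<close>.\<close>

lemma card_tail_le:
  fixes c :: "nat \<Rightarrow> real"
  assumes c: "\<And>i. i < n \<Longrightarrow> \<bar>c i\<bar> \<le> 1 / 2 ^ m" and n: "n \<le> (2 ^ m)\<^sup>2" and q: "q \<le> 2 ^ m"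
  shows "real (card {cs. length cs = n * (6 * m + 8) \<and>
      a \<le> (\<Sum>i<n. c i * (of_bool (keys m n cs i < q) - real q / 2 ^ m))})
    \<le> 2 ^ (n * (6 * m + 8)) * exp (1 - a)" (is "real (card ?A) \<le> _")
proof -
  let ?L = "{cs :: bool list. length cs = n * (6 * m + 8)}"
  define h where "h i v = exp (c i * (of_bool (v < q) - real q / 2 ^ m))" for i v
  have A: "?A = {cs \<in> ?L. a \<le> (\<Sum>i<n. c i * (of_bool (keys m n cs i < q) - real q / 2 ^ m))}" by auto
  have "real (card ?A) = (\<Sum>cs\<in>?L. of_bool (a \<le> (\<Sum>i<n. c i * (of_bool (keys m n cs i < q) - real q / 2 ^ m))))"
    unfolding A by (simp add: sum.inter_filter finite_coins of_bool_def flip: card_eq_sum sum.inter_filter)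
  also have "\<dots> \<le> (\<Sum>cs\<in>?L. exp (- a) * (\<Prod>i<n. h i (keys m n cs i)))"
  proof (rule sum_mono)
    fix cs
    let ?s = "\<Sum>i<n. c i * (of_bool (keys m n cs i < q) - real q / 2 ^ m)"
    have "of_bool (a \<le> ?s) \<le> exp (?s - a)" by (simp add: of_bool_def)
    also have "\<dots> = exp (- a) * (\<Prod>i<n. h i (keys m n cs i))"
      by (simp add: h_def exp_diff exp_minus field_simps flip: exp_sum)
    finally show "of_bool (a \<le> ?s) \<le> exp (- a) * (\<Prod>i<n. h i (keys m n cs i))" .
  qed
  also have "\<dots> = exp (- a) * (\<Prod>i<n. 2 ^ (5 * m + 8) * (\<Sum>v<2 ^ m. h i v))"
    by (simp add: sum_prod_keys flip: sum_distrib_left)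
  also have "(\<Prod>i<n. 2 ^ (5 * m + 8) * (\<Sum>v<2 ^ m. h i v)) \<le> (\<Prod>i<n. 2 ^ (6 * m + 8) * exp (1 / (2 ^ m)\<^sup>2))"
  proof (rule prod_mono, intro conjI)
    fix i assume i: "i \<in> {..<n}"
    show "0 \<le> 2 ^ (5 * m + 8) * (\<Sum>v<2 ^ m. h i v)" 
      unfolding h_def by (intro mult_nonneg_nonneg sum_nonneg) auto
    have "(\<Sum>v<2 ^ m. h i v) \<le> 2 ^ m * exp (1 / (2 ^ m)\<^sup>2)"
      using mgf_centered_indicator[of "c i" "2 ^ m" q] c[of i] i q by (simp add: h_def)
    then have "2 ^ (5 * m + 8) * (\<Sum>v<2 ^ m. h i v) \<le> 2 ^ (5 * m + 8) * (2 ^ m * exp (1 / (2 ^ m)\<^sup>2))"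
      by (intro mult_left_mono) auto
    also have "\<dots> = 2 ^ (6 * m + 8) * exp (1 / (2 ^ m)\<^sup>2)"
      by (simp flip: power_add mult.assoc)
    finally show "2 ^ (5 * m + 8) * (\<Sum>v<2 ^ m. h i v) \<le> 2 ^ (6 * m + 8) * exp (1 / (2 ^ m)\<^sup>2)" .
  qed
  also have "\<dots> = 2 ^ (n * (6 * m + 8)) * exp (real n / (2 ^ m)\<^sup>2)"
    by (simp add: power_mult_distrib mult.commute flip: power_mult exp_of_nat_mult)
  also have "\<dots> \<le> 2 ^ (n * (6 * m + 8)) * exp 1"
  proof -
    have "real n \<le> (2 ^ m)\<^sup>2" using n by (metis of_nat_le_iff of_nat_numeral of_nat_power)
    then show ?thesis by simp
  qed
  finally show ?thesis by (simp add: exp_diff exp_minus field_simps)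
qed

text \<open>The exit test of the key loop spends one coin after the blocks; this discards
  it.\<close>

lemma keys_take: "keys m n (take (n * (6 * m + 8)) cs) = keys m n cs"
  by (induction n arbitrary: cs) (simp_all add: min_absorb1 drop_take)

text \<open>Transfers a count over the coins of the keys to whole coin strings, in which the
  \<open>s\<close> coins of the setup and the \<open>r\<close> coins after the keys are
  free.\<close>

lemma card_coins_middle:
  fixes P :: "bool list \<Rightarrow> bool"
  shows "card {cs. length cs = s + (l + r) \<and> P (take l (drop s cs))} = 2 ^ s * (card {y. length y = l \<and> P y} * 2 ^ r)"
proof -
  have card: "card {cs :: bool list. length cs = t \<and> Q cs} = (\<Sum>cs | length cs = t. of_bool (Q cs))" for t Q
  proof -
    have "{cs :: bool list. length cs = t \<and> Q cs} = {cs. length cs = t} \<inter> {cs. Q cs}" by auto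
    then show ?thesis using finite_coins[of t] by (simp add: of_bool_def sum.If_cases)
  qed
  have "(\<Sum>cs | length cs = s + (l + r). of_bool (P (take l (drop s cs))) :: nat) =
      (\<Sum>x :: bool list | length x = s. \<Sum>y | length y = l. \<Sum>z :: bool list | length z = r. of_bool (P y))"
    unfolding sum_coins_add by (intro sum.cong refl) auto
  then show ?thesis unfolding card by (simp add: card_coins flip: sum_distrib_left)
qed

section \<open>The windowed dynamic program\<close>

definition relax :: "int \<Rightarrow> int \<Rightarrow> nat \<Rightarrow> nat \<Rightarrow> (nat \<Rightarrow> nat) \<Rightarrow> nat \<Rightarrow> nat" where
  "relax lo hi w p F j =
    (if lo \<le> int j \<and> int j \<le> hi \<and> w \<le> j then max (F j) (F (j - w) + p) else F j)"

text \<open>Chosen as the value at which the doubling loop of the program stops;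
  \<open>2 ^ bits n\<close> lies between sqrt n and twice that.\<close>

definition bits :: "nat \<Rightarrow> nat" where
  "bits n = (LEAST m. n \<le> (2 ^ m)\<^sup>2)"

lemma le_bits: "n \<le> (2 ^ bits n)\<^sup>2"
  unfolding bits_def
proof (rule LeastI[where P = "\<lambda>m. n \<le> (2 ^ m)\<^sup>2"])
  have "n \<le> 2 ^ n" using less_exp[of n] by simp
  also have "\<dots> \<le> (2 ^ n)\<^sup>2" by (simp add: power2_eq_square)
  finally show "n \<le> (2 ^ n)\<^sup>2" .
qed

lemma bits_le: "n \<ge> 1 \<Longrightarrow> (2 ^ bits n)\<^sup>2 \<le> 4 * n"
proof (cases "bits n")
  case (Suc m)
  then have "\<not> n \<le> (2 ^ m)\<^sup>2" unfolding bits_def using not_less_Least by (metis lessI)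
  then show ?thesis by (simp add: Suc power_mult_distrib)
qed simp

locale knapsack =
  fixes W :: nat and items :: "(nat \<times> nat) list"
  assumes valid: "valid_instance W items"
begin

definition n :: nat where "n = length items"
definition w :: "nat \<Rightarrow> nat" where "w i = fst (items ! i)"
definition p :: "nat \<Rightarrow> nat" where "p i = snd (items ! i)"
definition wm :: nat where "wm = wmax items"
definition m :: nat where "m = bits n"
definition K :: nat where "K = 2 ^ m"
definition cap :: nat where "cap = min W (\<Sum>i<n. w i)"
text \<open>In units of \<open>wm * K\<close> the threshold is \<open>4 * (m + 1)\<close>. The
  resulting factor \<open>exp (1 - 4 * (m + 1))\<close> has to absorb a union over
  \<open>2 * K\<close> tails and the factor \<open>n + 1\<close>, together at most
  \<open>2 ^ (3 * m + 2)\<close>.\<close>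

definition dev :: nat where "dev = 4 * wm * K * (m + 1)"
definition lo :: "nat \<Rightarrow> int" where "lo q = int (q * cap div K) - int dev"
definition hi :: "nat \<Rightarrow> int" where "hi q = int ((q + 1) * cap div K) + int dev + int wm"

text \<open>Each phase runs through the indices downwards: in \<open>processed key q i\<close> the items of phase
  \<open>q\<close> with indices below \<open>i\<close> are still to come.\<close>

definition processed :: "(nat \<Rightarrow> nat) \<Rightarrow> nat \<Rightarrow> nat \<Rightarrow> nat set" where
  "processed key q i = {i'. i' < n \<and> (key i' < q \<or> key i' = q \<and> i \<le> i')}"

primrec phase :: "(nat \<Rightarrow> nat) \<Rightarrow> nat \<Rightarrow> nat \<Rightarrow> (nat \<Rightarrow> nat) \<Rightarrow> nat \<Rightarrow> nat" where
  "phase key q 0 F = F"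
| "phase key q (Suc i) F =
    phase key q i (if key i = q then relax (lo q) (hi q) (w i) (p i) F else F)"

primrec dp :: "(nat \<Rightarrow> nat) \<Rightarrow> nat \<Rightarrow> nat \<Rightarrow> nat" where
  "dp key 0 = (\<lambda>_. 0)"
| "dp key (Suc q) = phase key q n (dp key q)"

lemma n_pos: "n \<ge> 1"
  using valid by (auto simp: valid_instance_def n_def Suc_le_eq)

lemma w_pos: "i < n \<Longrightarrow> w i > 0" and p_pos: "i < n \<Longrightarrow> p i > 0"
  using valid nth_mem[of i items] by (auto simp: valid_instance_def n_def w_def p_def case_prod_beta)

lemma w_le_wm: "i < n \<Longrightarrow> w i \<le> wm"
  by (simp add: w_def wm_def wmax_def n_def)

lemma wm_le_sum: "wm \<le> (\<Sum>i<n. w i)" and wm_attained: "\<exists>i<n. wm = w i"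
proof -
  have "wm \<in> fst ` set items" unfolding wm_def wmax_def
    using valid by (intro Max_in) (auto simp: valid_instance_def)
  then obtain i where "i < n" "wm = w i" by (auto simp: n_def w_def in_set_conv_nth)
  then show "\<exists>i<n. wm = w i" by blast
  then show "wm \<le> (\<Sum>i<n. w i)" using member_le_sum[of _ "{..<n}" w] by auto
qed

lemma wm_pos: "wm > 0"
  using n_pos w_pos[of 0] w_le_wm[of 0] by linarith

lemma n_le_K: "n \<le> K\<^sup>2" and K_le_n: "K\<^sup>2 \<le> 4 * n"
  using le_bits bits_le n_pos by (auto simp: K_def m_def)

lemma K_pos: "K > 0"
  by (simp add: K_def)

lemma processed_step: "i < n \<Longrightarrow> processed key q i = (if key i = q then insert i (processed key q (Suc i)) else processed key q (Suc i))"
  by (auto simp: processed_def Suc_le_eq order_le_less)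

lemma not_in_processed: "i \<notin> processed key q (Suc i) \<or> key i \<noteq> q"
  by (auto simp: processed_def)

lemma processed_0: "processed key q 0 = processed key (Suc q) n"
  by (auto simp: processed_def less_Suc_eq)

lemma processed_subset: "processed key q i \<subseteq> {..<n}"
  by (auto simp: processed_def)

lemma finite_processed: "finite (processed key q i)"
  by (rule finite_subset[OF processed_subset]) simp

section \<open>Soundness: the table never exceeds the optimum\<close>

text \<open>A feasible witness for each entry, with no claim of optimality: this survives any
  restriction of the updates to a window.\<close>

definition sound :: "nat set \<Rightarrow> (nat \<Rightarrow> nat) \<Rightarrow> bool" where
  "sound A F \<longleftrightarrow> (\<forall>j. \<exists>S\<subseteq>A. sum w S \<le> j \<and> sum p S = F j)"

lemma sound_insert:
  assumes "sound A F" "i \<notin> A" "finite A"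
  shows "sound (insert i A) (relax l h (w i) (p i) F)"
  unfolding sound_def
proof
  fix j
  show "\<exists>S\<subseteq>insert i A. sum w S \<le> j \<and> sum p S = relax l h (w i) (p i) F j"
  proof (cases "relax l h (w i) (p i) F j = F j")
    case True
    then show ?thesis using assms(1) unfolding sound_def by (metis subset_insertI2)
  next
    case False
    then have j: "w i \<le> j" and F: "relax l h (w i) (p i) F j = F (j - w i) + p i"
      by (auto simp: relax_def max_def split: if_splits)
    obtain S where S: "S \<subseteq> A" "sum w S \<le> j - w i" "sum p S = F (j - w i)"
      using assms(1) unfolding sound_def by blast
    then have "finite S" "i \<notin> S" using assms finite_subset by auto
    then have "sum w (insert i S) \<le> j" "sum p (insert i S) = F (j - w i) + p i"
      using S j by auto
    then show ?thesis unfolding F using S(1) by (metis insert_mono)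
  qed
qed

lemma sound_phase:
  "i \<le> n \<Longrightarrow> sound (processed key q i) F \<Longrightarrow> sound (processed key q 0) (phase key q i F)"
proof (induction i arbitrary: F)
  case (Suc i)
  have "sound (processed key q i) (if key i = q then relax (lo q) (hi q) (w i) (p i) F else F)"
    using Suc.prems sound_insert[OF Suc.prems(2) _ finite_processed] not_in_processed[of i key q] processed_step[of i key q]
    by auto
  then show ?case using Suc by simp
qed simp

lemma sound_dp: "sound (processed key q n) (dp key q)"
proof (induction q)
  case 0
  show ?case unfolding sound_def by (auto intro!: exI[of _ "{}"])
next
  case (Suc q)
  then show ?case using sound_phase[of n key q "dp key q"] by (simp add: processed_0)
qed

text \<open>The machine writes the candidate \<open>F j + p i\<close> before comparing it, so the
  candidate too must fit into a word.\<close>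

lemma sound_bound:
  assumes "sound A F" "A \<subseteq> {..<n}" "i < n" "i \<notin> A"
  shows "F j + p i \<le> (\<Sum>i<n. p i)"
proof -
  obtain S where S: "S \<subseteq> A" "sum p S = F j" using assms(1) unfolding sound_def by blast
  then have "finite S" "i \<notin> S" using assms finite_subset[of S "{..<n}"] by auto
  then have "F j + p i = sum p (insert i S)" using S by simp
  also have "\<dots> \<le> (\<Sum>i<n. p i)" using S assms by (intro sum_mono2) auto
  finally show ?thesis .
qed

lemma opt_eq: "knapsack_opt W items = Max {sum p S | S. S \<subseteq> {..<n} \<and> sum w S \<le> cap}"
proof -
  have "sum w S \<le> (\<Sum>i<n. w i)" if "S \<subseteq> {..<n}" for S using that by (intro sum_mono2) auto
  then have "sum w S \<le> cap \<longleftrightarrow> sum w S \<le> W" if "S \<subseteq> {..<n}" for S using that by (auto simp: cap_def)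
  then have "{sum p S | S. S \<subseteq> {..<n} \<and> sum w S \<le> cap} = {sum p S | S. S \<subseteq> {..<n} \<and> sum w S \<le> W}" by blast
  then show ?thesis unfolding knapsack_opt_def by (simp add: n_def w_def p_def)
qed

lemma finite_profits: "finite {sum p S | S. S \<subseteq> {..<n} \<and> sum w S \<le> cap}"
  by (rule finite_subset[of _ "sum p ` Pow {..<n}"]) auto

lemma le_opt: "S \<subseteq> {..<n} \<Longrightarrow> sum w S \<le> cap \<Longrightarrow> sum p S \<le> knapsack_opt W items"
  unfolding opt_eq by (rule Max_ge[OF finite_profits]) auto

lemma dp_le_opt: "dp key q cap \<le> knapsack_opt W items"
  using sound_dp[of key q] le_opt processed_subset[of key q n] unfolding sound_def by (metis subset_trans)

section \<open>Completeness: an optimal set that stays inside the windows is found\<close>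

lemma optimal_subset:
  obtains S where "S \<subseteq> {..<n}" "sum w S \<le> cap" "sum p S = knapsack_opt W items" "cap - sum w S < wm"
proof -
  have "{sum p S | S. S \<subseteq> {..<n} \<and> sum w S \<le> cap} \<noteq> {}" by (auto intro!: exI[of _ "{}"])
  then obtain S where S: "S \<subseteq> {..<n}" "sum w S \<le> cap" "sum p S = knapsack_opt W items"
    using Max_in[OF finite_profits] unfolding opt_eq by auto
  have "cap - sum w S < wm"
  proof (cases "S = {..<n}")
    case True
    then show ?thesis using wm_pos by (simp add: cap_def)
  next
    case False
    then obtain i where i: "i < n" "i \<notin> S" using S(1) by auto
    have fin: "finite S" using finite_subset[OF S(1)] by simp
    have "\<not> sum w (insert i S) \<le> cap"
      using le_opt[of "insert i S"] i S p_pos[of i] fin by auto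
    then have "cap - sum w S < w i" using i fin using S(2) by (simp add: not_le less_diff_conv2)
    then show ?thesis using w_le_wm[OF i(1)] by linarith
  qed
  then show ?thesis using that S by blast
qed

text \<open>The entry that follows the set \<open>S\<close> starts at the unused capacity \<open>\<delta>\<close> instead of \<open>0\<close>, so that it
  ends exactly at the capacity; this is possible because the table bounds weights only from above.\<close>

lemma phase_tracks:
  assumes "S \<subseteq> {..<n}"
    and "lo q \<le> int (\<delta> + sum w (S \<inter> processed key q n))" "int (\<delta> + sum w (S \<inter> processed key (Suc q) n)) \<le> hi q"
  shows "i \<le> n \<Longrightarrow> sum p (S \<inter> processed key q i) \<le> F (\<delta> + sum w (S \<inter> processed key q i)) \<Longrightarrow>
    sum p (S \<inter> processed key q 0) \<le> phase key q i F (\<delta> + sum w (S \<inter> processed key q 0))"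
proof (induction i arbitrary: F)
  case (Suc i)
  define G where "G = (if key i = q then relax (lo q) (hi q) (w i) (p i) F else F)"
  have G_ge: "F j \<le> G j" for j by (simp add: G_def relax_def)
  have "sum p (S \<inter> processed key q i) \<le> G (\<delta> + sum w (S \<inter> processed key q i))"
  proof (cases "key i = q \<and> i \<in> S")
    case True
    let ?A = "S \<inter> processed key q (Suc i)"
    have fin: "finite ?A" using finite_processed by blast
    have i: "i \<notin> ?A" using not_in_processed[of i key q] True by blast
    have eq: "S \<inter> processed key q i = insert i ?A" using True Suc.prems processed_step[of i key q] by auto
    \<comment> \<open>Weights along the phase lie between those at its two ends, so the window
      conditions at the ends cover every update in between.\<close>
    have mono: "sum w (S \<inter> processed key q n) \<le> sum w (S \<inter> processed key q i)"
      "sum w (S \<inter> processed key q i) \<le> sum w (S \<inter> processed key (Suc q) n)"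
      using Suc.prems(1) finite_processed by (auto intro!: sum_mono2 simp: processed_def)
    have "lo q \<le> int (\<delta> + sum w (insert i ?A))" "int (\<delta> + sum w (insert i ?A)) \<le> hi q"
      using mono assms(2,3) unfolding eq by linarith+
    moreover have "sum w (insert i ?A) = w i + sum w ?A" using fin i by simp
    ultimately have "F (\<delta> + sum w ?A) + p i \<le> G (\<delta> + sum w (insert i ?A))"
      using True by (simp add: G_def relax_def)
    then show ?thesis unfolding eq using Suc.prems(2) fin i by simp
  next
    case False
    then have "S \<inter> processed key q i = S \<inter> processed key q (Suc i)" using Suc.prems processed_step[of i key q] by auto
    then show ?thesis using Suc.prems(2) G_ge le_trans by fastforce
  qed
  then show ?case using Suc.IH Suc.prems(1) by (simp add: G_def)
qed simp

definition good :: "nat set \<Rightarrow> (nat \<Rightarrow> nat) \<Rightarrow> bool" where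
  "good S key \<longleftrightarrow> (\<forall>q<K.
    lo q \<le> int (cap - sum w S + sum w (S \<inter> processed key q n)) \<and>
    int (cap - sum w S + sum w (S \<inter> processed key (Suc q) n)) \<le> hi q)"

lemma dp_eq_opt:
  assumes S: "S \<subseteq> {..<n}" "sum w S \<le> cap" "sum p S = knapsack_opt W items"
    and good: "good S key" and key: "\<And>i. key i < K"
  shows "dp key K cap = knapsack_opt W items"
proof -
  have "sum p (S \<inter> processed key q n) \<le> dp key q (cap - sum w S + sum w (S \<inter> processed key q n))" if "q \<le> K" for q
    using that
  proof (induction q)
    case 0
    then show ?case by (auto simp: processed_def)
  next
    case (Suc q)
    then show ?case
      using phase_tracks[OF S(1), of q "cap - sum w S" key n "dp key q"] good by (simp add: good_def processed_0)
  qed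
  moreover have "S \<inter> processed key K n = S" using S(1) key by (auto simp: processed_def)
  ultimately have "sum p S \<le> dp key K cap" using S(2) by (metis le_add_diff_inverse2 le_refl)
  then show ?thesis using S(3) dp_le_opt[of key K] by simp
qed

section \<open>Concentration of the weight treated so far\<close>

lemma good_if_concentrated:
  assumes S: "S \<subseteq> {..<n}" "sum w S \<le> cap" "cap - sum w S < wm"
    and low: "\<And>q. q < K \<Longrightarrow> real (sum w S) * q / K - dev < sum w (S \<inter> processed key q n)"
    and high: "\<And>q. q < K \<Longrightarrow> sum w (S \<inter> processed key (Suc q) n) < real (sum w S) * Suc q / K + dev"
  shows "good S key"
  unfolding good_def
proof (intro allI impI conjI)
  fix q assume q: "q < K"
  define \<delta> where "\<delta> = cap - sum w S"
  have cap: "real cap = real (sum w S) + real \<delta>" and \<delta>: "real \<delta> < real wm"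
    using S(2,3) by (simp_all only: \<delta>_def flip: of_nat_add of_nat_less_iff)
  have qK: "real q / K \<le> 1" "real (Suc q) / K \<le> 1" using q by auto
  \<comment> \<open>The mean computed from \<open>cap\<close> exceeds the one computed from
    \<open>S\<close> by at most the offset \<delta>, which the tracked entry already
    carries.\<close>
  have "real (q * cap div K) \<le> real q * cap / K"
    using of_nat_div_le_of_nat[of "q * cap" K, where ?'a = real] by simp
  also have "\<dots> = real (sum w S) * q / K + \<delta> * (q / K)" unfolding cap by (simp add: algebra_simps add_divide_distrib)
  also have "\<dots> \<le> real (sum w S) * q / K + \<delta>" using mult_left_mono[OF qK(1), of \<delta>] by simp
  finally have "real (q * cap div K) - dev < \<delta> + sum w (S \<inter> processed key q n)" using low[OF q] by linarith
  then have "real_of_int (lo q) \<le> real_of_int (int (\<delta> + sum w (S \<inter> processed key q n)))" unfolding lo_def by simp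
  then show "lo q \<le> int (cap - sum w S + sum w (S \<inter> processed key q n))" unfolding \<delta>_def of_int_le_iff .
  have "real (sum w S) * Suc q / K \<le> real cap * Suc q / K"
    using S(2) by (intro divide_right_mono mult_right_mono) (auto simp only: of_nat_le_iff of_nat_0_le_iff)
  also have "\<dots> = real ((q + 1) * cap) / real K" by (simp add: algebra_simps)
  also have "\<dots> < real ((q + 1) * cap div K) + 1"
    using real_of_int_floor_add_one_gt[of "real ((q + 1) * cap) / real K"]
    unfolding floor_divide_of_nat_eq of_int_of_nat_eq .
  finally have "real (\<delta> + sum w (S \<inter> processed key (Suc q) n)) < real ((q + 1) * cap div K + 1 + dev + wm)"
    using high[OF q] \<delta> by simp
  \<comment> \<open>Between integers, the strict inequality pays for the \<open>1\<close> lost in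
    rounding the quotient.\<close>
  then have "\<delta> + sum w (S \<inter> processed key (Suc q) n) < (q + 1) * cap div K + 1 + dev + wm" unfolding of_nat_less_iff .
  then show "int (cap - sum w S + sum w (S \<inter> processed key (Suc q) n)) \<le> hi q"
    unfolding hi_def \<delta>_def by linarith
qed

lemma card_bad_le:
  assumes S: "S \<subseteq> {..<n}" "sum w S \<le> cap" "cap - sum w S < wm"
  shows "real (card {cs. length cs = n * (6 * m + 8) \<and> \<not> good S (keys m n cs)}) \<le> 2 ^ (n * (6 * m + 8)) / real (n + 1)"
proof -
  define dv where "dv cs q = real (sum w (S \<inter> processed (keys m n cs) q n)) - real (sum w S) * q / K" for cs q
  define lowtail where "lowtail q = {cs. length cs = n * (6 * m + 8) \<and> dv cs q \<le> - dev}" for q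
  define hightail where "hightail q = {cs. length cs = n * (6 * m + 8) \<and> dev \<le> dv cs q}" for q
  \<comment> \<open>Division by \<open>s\<close> gives every item a coefficient of absolute value at
    most \<open>1 / K\<close>, as \<open>card_tail_le\<close> demands; the deviation
    \<open>dev\<close> becomes \<open>4 * (m + 1)\<close>.\<close>
  define s where "s = real (wm * K)"
  have s: "s > 0" using wm_pos K_pos by (simp add: s_def)
  have dev: "real dev = s * (4 * (real m + 1))" by (simp add: dev_def s_def algebra_simps)
  have K2: "real K = 2 ^ m" by (simp add: K_def)
  have dv: "dv cs q = (\<Sum>i<n. of_bool (i \<in> S) * w i * (of_bool (keys m n cs i < q) - real q / 2 ^ m))" for cs q
  proof -
    have "real (sum w (S \<inter> processed (keys m n cs) q n)) = (\<Sum>i<n. of_bool (i \<in> S) * w i * of_bool (keys m n cs i < q))"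
      unfolding of_nat_sum by (rule sum.mono_neutral_cong_left) (use S in \<open>auto simp: processed_def\<close>)
    moreover have "real (sum w S) = (\<Sum>i<n. of_bool (i \<in> S) * w i)"
      unfolding of_nat_sum by (rule sum.mono_neutral_cong_left) (use S in auto)
    ultimately show ?thesis
      unfolding dv_def K2 
      by (simp only: right_diff_distrib sum_subtractf times_divide_eq_right sum_distrib_right sum_divide_distrib
          of_nat_sum of_nat_mult of_nat_of_bool)
  qed
  have tail: "real (card {cs. length cs = n * (6 * m + 8) \<and> dev \<le> e * dv cs q}) \<le> 2 ^ (n * (6 * m + 8)) * exp (1 - 4 * (real m + 1))"
    if "q \<le> K" "e = 1 \<or> e = - 1" for q e
  proof -
    define c where "c i = e * (of_bool (i \<in> S) * w i) / s" for i
    have "\<bar>c i\<bar> \<le> 1 / 2 ^ m" if "i < n" for i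
    proof -
      have "\<bar>c i\<bar> \<le> wm / s" using that w_le_wm[of i] s \<open>e = 1 \<or> e = - 1\<close> unfolding c_def
        by (auto simp: abs_mult intro!: divide_right_mono)
      then show ?thesis using wm_pos by (simp add: s_def K2)
    qed
    then have "real (card {cs. length cs = n * (6 * m + 8) \<and>
        4 * (real m + 1) \<le> (\<Sum>i<n. c i * (of_bool (keys m n cs i < q) - real q / 2 ^ m))})
      \<le> 2 ^ (n * (6 * m + 8)) * exp (1 - 4 * (real m + 1))"
      using card_tail_le[of n c m q "4 * (real m + 1)"] n_le_K that(1) by (simp add: K_def)
    moreover have "(\<Sum>i<n. c i * (of_bool (keys m n cs i < q) - real q / 2 ^ m)) = e * dv cs q / s" for cs
      unfolding dv c_def
      by (simp only: sum_distrib_left sum_divide_distrib times_divide_eq_left mult.assoc)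
    moreover have "4 * (real m + 1) \<le> e * dv cs q / s \<longleftrightarrow> dev \<le> e * dv cs q" for cs
      unfolding dev using s by (simp add: pos_le_divide_eq mult.commute)
    ultimately show ?thesis by simp
  qed
  let ?B = "2 ^ (n * (6 * m + 8)) * exp (1 - 4 * (real m + 1))"
  have low: "real (card (lowtail q)) \<le> ?B" and high: "real (card (hightail q)) \<le> ?B" if "q \<le> K" for q
    using tail[OF that, of "-1"] tail[OF that, of 1] by (simp_all add: lowtail_def hightail_def le_minus_iff add.commute)
  have fin: "finite (lowtail q)" "finite (hightail q)" for q
    by (auto simp: lowtail_def hightail_def intro: finite_subset[OF _ finite_coins])
  have "{cs. length cs = n * (6 * m + 8) \<and> \<not> good S (keys m n cs)} \<subseteq> (\<Union>q<K. lowtail q \<union> hightail (Suc q))"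
  proof
    fix cs assume cs: "cs \<in> {cs. length cs = n * (6 * m + 8) \<and> \<not> good S (keys m n cs)}"
    show "cs \<in> (\<Union>q<K. lowtail q \<union> hightail (Suc q))"
    proof (rule ccontr)
      assume "\<not> ?thesis"
      then have "- dev < dv cs q" "dv cs (Suc q) < dev" if "q < K" for q
        using that cs by (force simp: lowtail_def hightail_def not_le)+
      then have "good S (keys m n cs)" unfolding dv_def by (intro good_if_concentrated[OF S]) (force simp: algebra_simps)+
      then show False using cs by simp
    qed
  qed
  then have "card {cs. length cs = n * (6 * m + 8) \<and> \<not> good S (keys m n cs)} \<le> card (\<Union>q<K. lowtail q \<union> hightail (Suc q))"
    using fin by (intro card_mono) auto
  also have "\<dots> \<le> (\<Sum>q<K. card (lowtail q \<union> hightail (Suc q)))" by (rule card_UN_le) simp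
  also have "\<dots> \<le> (\<Sum>q<K. card (lowtail q) + card (hightail (Suc q)))" by (intro sum_mono card_Un_le)
  finally have "real (card {cs. length cs = n * (6 * m + 8) \<and> \<not> good S (keys m n cs)})
      \<le> (\<Sum>q<K. real (card (lowtail q)) + real (card (hightail (Suc q))))"
    by (simp flip: of_nat_add of_nat_sum)
  also have "\<dots> \<le> (\<Sum>q<K. ?B + ?B)" using low high by (intro sum_mono add_mono) auto
  also have "\<dots> = 2 ^ (n * (6 * m + 8)) * (2 * 2 ^ m * exp (1 - 4 * (real m + 1)))" by (simp add: K2)
  also have "\<dots> \<le> 2 ^ (n * (6 * m + 8)) * (1 / real (n + 1))"
  proof (rule mult_left_mono)
    have e2: "(2::real) \<le> exp 1" using exp_ge_add_one_self[of 1] by simp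
    have "real n \<le> (2 ^ m)\<^sup>2" using n_le_K unfolding K_def by (metis of_nat_le_iff of_nat_numeral of_nat_power)
    moreover have "(1::real) \<le> (2 ^ m)\<^sup>2" by simp
    ultimately have "real (n + 1) \<le> 2 * (2 ^ m)\<^sup>2" by linarith
    then have "2 * 2 ^ m * real (n + 1) \<le> 2 * 2 ^ m * (2 * (2 ^ m)\<^sup>2)" by (intro mult_left_mono) auto
    also have "\<dots> = 2 ^ (3 * m + 2)" by (simp add: power_add power2_eq_square power_mult flip: power_mult_distrib)
    \<comment> \<open>The choice of the factor 4 in \<open>dev\<close> pays off here:
      \<open>3 * m + 2\<close> is at most \<open>4 * (m + 1) - 1\<close>.\<close>
    also have "\<dots> \<le> exp 1 ^ (3 * m + 2)" by (intro power_mono e2) auto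
    also have "\<dots> \<le> exp (4 * (real m + 1) - 1)" unfolding exp_of_nat_mult[symmetric] by simp
    finally have "2 * 2 ^ m \<le> exp (4 * (real m + 1) - 1) / real (n + 1)"
      by (simp add: pos_le_divide_eq)
    then have "2 * 2 ^ m * exp (1 - 4 * (real m + 1)) \<le> exp (4 * (real m + 1) - 1) / real (n + 1) * exp (1 - 4 * (real m + 1))"
      by (intro mult_right_mono) auto
    also have "\<dots> = 1 / real (n + 1)" by (simp flip: exp_add)
    finally show "2 * 2 ^ m * exp (1 - 4 * (real m + 1)) \<le> 1 / real (n + 1)" .
  qed simp
  finally show ?thesis by simp
qed

end

section \<open>The program\<close>

text \<open>The input occupies the addresses \<open>0\<close> to \<open>2 * n + 1\<close>; the table follows from \<open>2 * n + 2\<close> on.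
  Registers are small negative addresses, and the key of the item with index \<open>i\<close> is at \<open>- 41 - i\<close>.
  Register \<open>rZero\<close> is never written; testing it is an unconditional jump.\<close>

abbreviation (input) "rZero \<equiv> - 1 :: int"
abbreviation (input) "rOne \<equiv> - 2 :: int"
abbreviation (input) "rI \<equiv> - 3 :: int"
abbreviation (input) "rCap \<equiv> - 4 :: int"
abbreviation (input) "rMax \<equiv> - 5 :: int"
abbreviation (input) "rA \<equiv> - 6 :: int"
abbreviation (input) "rW \<equiv> - 7 :: int"
abbreviation (input) "rT \<equiv> - 8 :: int"
abbreviation (input) "rK \<equiv> - 9 :: int"
abbreviation (input) "rM \<equiv> - 10 :: int"
abbreviation (input) "rDev \<equiv> - 11 :: int"
abbreviation (input) "rBase \<equiv> - 12 :: int"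
abbreviation (input) "rKeys \<equiv> - 13 :: int"
abbreviation (input) "rKey \<equiv> - 14 :: int"
abbreviation (input) "rJ \<equiv> - 15 :: int"
abbreviation (input) "rR \<equiv> - 16 :: int"
abbreviation (input) "rQ \<equiv> - 17 :: int"
abbreviation (input) "rLo \<equiv> - 18 :: int"
abbreviation (input) "rHi \<equiv> - 19 :: int"
abbreviation (input) "rP \<equiv> - 20 :: int"
abbreviation (input) "rC \<equiv> - 21 :: int"
abbreviation (input) "rX \<equiv> - 22 :: int"
abbreviation (input) "rY \<equiv> - 23 :: int"

text \<open>Loop heads: 2 (sum and maximum of the weights),
  15 (doubling of \<open>K\<close>), 32 (keys) with 35 (bits), 45 (phases), 58 (items), 69 (table entries, downwards).
  The registers \<open>rLo\<close> and \<open>rHi\<close> hold addresses, that is, the window shifted by the start of the table.\<close>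

definition prog :: "instr list" where
  "prog = [
    Const rOne 1, Add rI 0 rZero,
    Jz rI 11, Add rA rI rI, Load rW rA, Add rCap rCap rW, Sub rT rW rMax, Jneg rT 9,
    Add rMax rW rZero, Sub rI rI rOne, Jz rZero 2,
    Sub rT rCap 1, Jneg rT 14, Add rCap 1 rZero,
    Const rK 1,
    Mul rT rK rK, Sub rT rT 0, Jneg rT 19, Jz rZero 22, Add rK rK rK, Add rM rM rOne,
    Jz rZero 15,
    Add rT rM rOne, Mul rDev rK rMax, Mul rDev rDev rT, Const rT 4, Mul rDev rDev rT,
    Add rBase 0 0, Add rBase rBase rOne, Add rBase rBase rOne, Const rKeys (- 40),
    Add rI 0 rZero,
    Jz rI 45, Const rKey 0, Add rJ rM rZero,
    Jz rJ 41, Rand rR, Add rKey rKey rKey, Add rKey rKey rR, Sub rJ rJ rOne, Jz rZero 35,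
    Sub rA rKeys rI, Store rA rKey, Sub rI rI rOne, Jz rZero 32,
    Sub rT rQ rK, Jz rT 86, Mul rLo rQ rCap, Div rLo rLo rK, Sub rLo rLo rDev,
    Add rLo rLo rBase, Add rT rQ rOne, Mul rHi rT rCap, Div rHi rHi rK, Add rHi rHi rDev,
    Add rHi rHi rMax, Add rHi rHi rBase, Add rI 0 rZero,
    Jz rI 84, Sub rA rKeys rI, Load rT rA, Sub rT rT rQ, Jz rT 64, Jz rZero 82,
    Add rA rI rI, Load rW rA, Add rA rA rOne, Load rP rA, Add rA rHi rZero,
    Sub rT rA rLo, Jneg rT 82, Sub rC rA rW, Sub rT rC rBase, Jneg rT 82, Load rY rC,
    Add rY rY rP, Load rX rA, Sub rT rY rX, Jneg rT 80, Store rA rY, Sub rA rA rOne,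
    Jz rZero 69,
    Sub rI rI rOne, Jz rZero 58,
    Add rQ rQ rOne, Jz rZero 45,
    Add rA rBase rCap, Load 0 rA, Halt]"

lemma length_prog: "length prog = 89"
  by (simp add: prog_def)

lemma prog_nth:
  "prog ! 0 = Const rOne 1" "prog ! Suc 0 = Add rI 0 rZero" "prog ! 2 = Jz rI 11"
  "prog ! 3 = Add rA rI rI" "prog ! 4 = Load rW rA" "prog ! 5 = Add rCap rCap rW"
  "prog ! 6 = Sub rT rW rMax" "prog ! 7 = Jneg rT 9" "prog ! 8 = Add rMax rW rZero"
  "prog ! 9 = Sub rI rI rOne" "prog ! 10 = Jz rZero 2" "prog ! 11 = Sub rT rCap 1"
  "prog ! 12 = Jneg rT 14" "prog ! 13 = Add rCap 1 rZero" "prog ! 14 = Const rK 1"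
  "prog ! 15 = Mul rT rK rK" "prog ! 16 = Sub rT rT 0" "prog ! 17 = Jneg rT 19"
  "prog ! 18 = Jz rZero 22" "prog ! 19 = Add rK rK rK" "prog ! 20 = Add rM rM rOne"
  "prog ! 21 = Jz rZero 15" "prog ! 22 = Add rT rM rOne" "prog ! 23 = Mul rDev rK rMax"
  "prog ! 24 = Mul rDev rDev rT" "prog ! 25 = Const rT 4" "prog ! 26 = Mul rDev rDev rT"
  "prog ! 27 = Add rBase 0 0" "prog ! 28 = Add rBase rBase rOne"
  "prog ! 29 = Add rBase rBase rOne" "prog ! 30 = Const rKeys (- 40)" "prog ! 31 = Add rI 0 rZero"
  "prog ! 32 = Jz rI 45" "prog ! 33 = Const rKey 0" "prog ! 34 = Add rJ rM rZero"
  "prog ! 35 = Jz rJ 41" "prog ! 36 = Rand rR" "prog ! 37 = Add rKey rKey rKey"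
  "prog ! 38 = Add rKey rKey rR" "prog ! 39 = Sub rJ rJ rOne" "prog ! 40 = Jz rZero 35"
  "prog ! 41 = Sub rA rKeys rI" "prog ! 42 = Store rA rKey" "prog ! 43 = Sub rI rI rOne"
  "prog ! 44 = Jz rZero 32" "prog ! 45 = Sub rT rQ rK" "prog ! 46 = Jz rT 86"
  "prog ! 47 = Mul rLo rQ rCap" "prog ! 48 = Div rLo rLo rK" "prog ! 49 = Sub rLo rLo rDev"
  "prog ! 50 = Add rLo rLo rBase" "prog ! 51 = Add rT rQ rOne" "prog ! 52 = Mul rHi rT rCap"
  "prog ! 53 = Div rHi rHi rK" "prog ! 54 = Add rHi rHi rDev" "prog ! 55 = Add rHi rHi rMax"
  "prog ! 56 = Add rHi rHi rBase" "prog ! 57 = Add rI 0 rZero" "prog ! 58 = Jz rI 84"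
  "prog ! 59 = Sub rA rKeys rI" "prog ! 60 = Load rT rA" "prog ! 61 = Sub rT rT rQ"
  "prog ! 62 = Jz rT 64" "prog ! 63 = Jz rZero 82" "prog ! 64 = Add rA rI rI"
  "prog ! 65 = Load rW rA" "prog ! 66 = Add rA rA rOne" "prog ! 67 = Load rP rA"
  "prog ! 68 = Add rA rHi rZero" "prog ! 69 = Sub rT rA rLo" "prog ! 70 = Jneg rT 82"
  "prog ! 71 = Sub rC rA rW" "prog ! 72 = Sub rT rC rBase" "prog ! 73 = Jneg rT 82"
  "prog ! 74 = Load rY rC" "prog ! 75 = Add rY rY rP" "prog ! 76 = Load rX rA"
  "prog ! 77 = Sub rT rY rX" "prog ! 78 = Jneg rT 80" "prog ! 79 = Store rA rY"
  "prog ! 80 = Sub rA rA rOne" "prog ! 81 = Jz rZero 69" "prog ! 82 = Sub rI rI rOne"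
  "prog ! 83 = Jz rZero 58" "prog ! 84 = Add rQ rQ rOne" "prog ! 85 = Jz rZero 45"
  "prog ! 86 = Add rA rBase rCap" "prog ! 87 = Load 0 rA" "prog ! 88 = Halt"
  by (simp_all add: prog_def)

section \<open>Counting steps when every step consumes a coin\<close>

definition steps :: "nat \<Rightarrow> nat \<Rightarrow> config \<Rightarrow> config \<Rightarrow> bool" where
  "steps b t c c' \<longleftrightarrow> (\<forall>cs. length cs = t \<longrightarrow> foldl (step prog b) c cs = c')"

text \<open>The hidden count \<open>s\<close> is chosen before the coins, so unfolding
  \<open>reach\<close> still yields an exact position in the coin string.\<close>

definition reach :: "nat \<Rightarrow> nat \<Rightarrow> config \<Rightarrow> config \<Rightarrow> bool" where
  "reach b t c c' \<longleftrightarrow> (\<exists>s\<le>t. steps b s c c')"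

lemma steps_0: "steps b 0 c c' \<longleftrightarrow> c = c'"
  by (simp add: steps_def)

lemma steps_Suc: "steps b (Suc t) c c' \<longleftrightarrow> (\<forall>x. steps b t (step prog b c x) c')"
proof
  assume L: "steps b (Suc t) c c'"
  show "\<forall>x. steps b t (step prog b c x) c'"
    unfolding steps_def
  proof (intro allI impI)
    fix x and cs :: "bool list" assume "length cs = t"
    then show "foldl (step prog b) (step prog b c x) cs = c'"
      using L[unfolded steps_def, rule_format, of "x # cs"] by simp
  qed
qed (auto simp: steps_def length_Suc_conv)

lemma steps_numeral: "steps b (numeral k) c c' \<longleftrightarrow> (\<forall>x. steps b (pred_numeral k) (step prog b c x) c')"
  by (simp add: numeral_eq_Suc steps_Suc)

lemma steps_add: "steps b s c c' \<Longrightarrow> steps b t c' c'' \<Longrightarrow> steps b (s + t) c c''"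
  unfolding steps_def
proof (intro allI impI)
  fix cs :: "bool list"
  assume "\<forall>cs. length cs = s \<longrightarrow> foldl (step prog b) c cs = c'" "\<forall>cs. length cs = t \<longrightarrow> foldl (step prog b) c' cs = c''"
    "length cs = s + t"
  then show "foldl (step prog b) c cs = c''"
    using foldl_append[of "step prog b" c "take s cs" "drop s cs"] by simp
qed

lemma reach_steps: "steps b s c c' \<Longrightarrow> s \<le> t \<Longrightarrow> reach b t c c'"
  by (auto simp: reach_def)

lemma reach_mono: "reach b s c c' \<Longrightarrow> s \<le> t \<Longrightarrow> reach b t c c'"
  unfolding reach_def using le_trans by blast

lemma reach_trans: "reach b s c c' \<Longrightarrow> reach b t c' c'' \<Longrightarrow> reach b (s + t) c c''"
  unfolding reach_def using steps_add add_mono by blast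

lemma reach_refl: "reach b t c c"
  by (auto simp: reach_def steps_def intro!: exI[of _ 0])

text \<open>Registers are negative, input and table are not; these inequalities let the simplifier
  resolve memory updates during symbolic execution.\<close>

lemma address_neq:
  fixes a :: int
  shows "0 \<le> a \<Longrightarrow> a \<noteq> - numeral k" "0 \<le> a \<Longrightarrow> - numeral k \<noteq> a" "0 \<le> a \<Longrightarrow> a \<noteq> - 1" "0 \<le> a \<Longrightarrow> - 1 \<noteq> a"
  by auto

lemma fits_register: "40 < (2 :: int) ^ b \<Longrightarrow> (numeral k :: int) \<le> 40 \<Longrightarrow> fits b (- numeral k)"
  unfolding fits_def abs_minus_cancel abs_numeral using le_less_trans by blast

lemmas exec_simps = steps_0 steps_Suc steps_numeral length_prog prog_nth upd_def address_neq fits_register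

section \<open>Symbolic execution of the segments between loop heads\<close>

text \<open>The counter \<open>rI\<close> runs from \<open>n\<close> down to \<open>1\<close> and is
  one more than the index of the item, so that doubling it gives the address of the weight. Skipping
  the update of the maximum saves one step.\<close>

lemma exec_scan:
  assumes "40 < (2 :: int) ^ b" "M rZero = 0" "M rOne = 1" "M rI = i" "i > 0" "M (i + i) = v" "M rCap = c" "M rMax = x"
    and "fits b (i + i)" "fits b v" "fits b (c + v)" "fits b (v - x)" "fits b (i - 1)"
  shows "steps b (if v < x then 8 else 9) (Run 2 M)
    (Run 2 (M(rA := i + i, rW := v, rCap := c + v, rT := v - x, rMax := max x v, rI := i - 1)))"
proof -
  have "0 \<le> i + i" "i \<noteq> 0" using assms by auto
  show ?thesis
  proof (cases "v < x")
    case True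
    then show ?thesis using assms(1-4,6-) \<open>i \<noteq> 0\<close> \<open>0 \<le> i + i\<close> by (simp add: exec_simps; simp add: fun_eq_iff)
  next
    case False
    then show ?thesis using assms(1-4,6-) \<open>i \<noteq> 0\<close> \<open>0 \<le> i + i\<close> by (simp add: exec_simps; simp add: fun_eq_iff)
  qed
qed

lemma exec_clamp:
  assumes "40 < (2 :: int) ^ b" "M rZero = 0" "M rCap = c" "M 1 = x" "fits b 1" "fits b x" "fits b (c - x)"
  shows "steps b (if c < x then 3 else 4) (Run 11 M) (Run 15 (M(rT := c - x, rCap := min x c, rK := 1)))"
  using assms by (cases "c < x"; simp add: exec_simps; simp add: fun_eq_iff)

lemma exec_double:
  assumes "40 < (2 :: int) ^ b" "M rZero = 0" "M rOne = 1" "M 0 = n" "M rK = k" "M rM = m" "k * k < n"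
    and "fits b (k * k)" "fits b (k * k - n)" "fits b (k + k)" "fits b (m + 1)"
  shows "steps b 6 (Run 15 M) (Run 15 (M(rT := k * k - n, rK := k + k, rM := m + 1)))"
  using assms by (simp add: exec_simps; simp add: fun_eq_iff)

lemma exec_double_exit:
  assumes "40 < (2 :: int) ^ b" "M rZero = 0" "M 0 = n" "M rK = k" "\<not> k * k < n"
    and "fits b (k * k)" "fits b (k * k - n)"
  shows "steps b 4 (Run 15 M) (Run 22 (M(rT := k * k - n)))"
  using assms by (simp add: exec_simps; simp add: fun_eq_iff)

lemma exec_setup:
  assumes "40 < (2 :: int) ^ b" "M rZero = 0" "M rOne = 1" "M 0 = n" "M rK = k" "M rM = m" "M rMax = x"
    and "fits b (m + 1)" "fits b (k * x)" "fits b (k * x * (m + 1))" "fits b 4" "fits b (k * x * (m + 1) * 4)"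
    and "fits b n" "fits b (n + n)" "fits b (n + n + 1)" "fits b (n + n + 1 + 1)" "fits b (- 40)"
  shows "steps b 10 (Run 22 M)
    (Run 32 (M(rT := 4, rDev := k * x * (m + 1) * 4, rBase := n + n + 1 + 1, rKeys := - 40, rI := n)))"
  using assms by (simp add: exec_simps; simp add: fun_eq_iff)

text \<open>This is the only segment whose result depends on a coin, hence the explicit coins in
  place of \<open>steps\<close>.\<close>

lemma exec_bit:
  assumes "40 < (2 :: int) ^ b" "M rZero = 0" "M rOne = 1" "M rJ = j" "j \<noteq> 0" "M rKey = k"
    and "fits b 0" "fits b 1" "fits b (k + k)" "fits b (k + k + of_bool c1)" "fits b (j - 1)"
  shows "foldl (step prog b) (Run 35 M) [c0, c1, c2, c3, c4, c5] =
    Run 35 (M(rR := of_bool c1, rKey := k + k + of_bool c1, rJ := j - 1))"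
  using assms by (cases c1; simp add: exec_simps; simp add: fun_eq_iff)

lemma exec_key_start:
  assumes "40 < (2 :: int) ^ b" "M rZero = 0" "M rI \<noteq> 0" "M rM = m" "fits b 0" "fits b m"
  shows "steps b 3 (Run 32 M) (Run 35 (M(rKey := 0, rJ := m)))"
  using assms by (simp add: exec_simps; simp add: fun_eq_iff)

lemma exec_key_store:
  assumes "40 < (2 :: int) ^ b" "M rZero = 0" "M rOne = 1" "M rJ = 0" "M rI = i" "i > 0" "M rKeys = - 40" "M rKey = k"
    and "fits b (- 40 - i)" "fits b k" "fits b (i - 1)"
  shows "steps b 5 (Run 35 M) (Run 32 (M(rA := - 40 - i, - 40 - i := k, rI := i - 1)))"
  using assms by (simp add: exec_simps; simp add: fun_eq_iff)

lemma exec_window: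
  assumes "40 < (2 :: int) ^ b" "M rZero = 0" "M rOne = 1" "M 0 = n" "M rQ = q" "M rK = k" "q \<noteq> k" "M rCap = c"
    "M rDev = d" "M rMax = x" "M rBase = r"
    and "fits b n" "fits b (q - k)" "fits b (q * c)" "fits b (q * c div k)" "fits b (q * c div k - d)" "fits b (q * c div k - d + r)"
    "fits b (q + 1)" "fits b ((q + 1) * c)" "fits b ((q + 1) * c div k)" "fits b ((q + 1) * c div k + d)"
    "fits b ((q + 1) * c div k + d + x)" "fits b ((q + 1) * c div k + d + x + r)"
  shows "steps b 13 (Run 45 M) (Run 58 (M(rT := q + 1, rLo := q * c div k - d + r, rHi := (q + 1) * c div k + d + x + r, rI := n)))"
  using assms by (simp add: exec_simps; simp add: fun_eq_iff)

lemma exec_skip: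
  assumes "40 < (2 :: int) ^ b" "M rZero = 0" "M rI = i" "i > 0" "M rKeys = - 40" "M (- 40 - i) = k" "M rQ = q" "k \<noteq> q"
    and "fits b (- 40 - i)" "fits b k" "fits b (k - q)"
  shows "steps b 6 (Run 58 M) (Run 82 (M(rA := - 40 - i, rT := k - q)))"
  using assms by (simp add: exec_simps; simp add: fun_eq_iff)

lemma exec_fetch:
  assumes "40 < (2 :: int) ^ b" "M rZero = 0" "M rOne = 1" "M rI = i" "i > 0" "M rKeys = - 40" "M (- 40 - i) = q" "M rQ = q"
    "M (i + i) = v" "M (i + i + 1) = u" "M rHi = h"
    and "fits b (- 40 - i)" "fits b q" "fits b 0" "fits b (i + i)" "fits b (i + i + 1)" "fits b v" "fits b u" "fits b h"
  shows "steps b 10 (Run 58 M) (Run 69 (M(rT := 0, rW := v, rP := u, rA := h)))"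
  using assms by (simp add: exec_simps; simp add: fun_eq_iff)

lemma exec_relax:
  assumes "40 < (2 :: int) ^ b" "M rZero = 0" "M rOne = 1" "M rA = A" "M rLo = L" "M rW = v" "M rBase = B" "M rP = u" "M A = x" "M C = y"
    "A - v = C" "y + u = z" "\<not> A < L" "\<not> C < B" "0 \<le> A" "0 \<le> C"
    and "fits b A" "fits b C" "fits b (A - L)" "fits b (C - B)" "fits b (A - 1)" "fits b y" "fits b x" "fits b z" "fits b (z - x)"
  shows "steps b (if z < x then 12 else 13) (Run 69 M)
    (Run 69 (M(rT := z - x, rC := C, rY := z, rX := x, A := max x z, rA := A - 1)))"
proof (cases "z < x")
  case True
  then show ?thesis using assms by (simp add: exec_simps; simp add: fun_eq_iff)
next
  case False
  then show ?thesis using assms by (simp add: exec_simps; simp add: fun_eq_iff)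
qed

lemma exec_finish:
  assumes "40 < (2 :: int) ^ b" "M rQ = k" "M rK = k" "M rBase = r" "M rCap = c" "0 \<le> r + c" "M (r + c) = v"
    and "fits b (r + c)" "fits b 0" "fits b v"
  shows "steps b 5 (Run 45 M) (Done v)"
  using assms by (simp add: exec_simps)

section \<open>Execution\<close>

text \<open>Every number the program writes is at most \<open>1000 * X\<close> in absolute value.\<close>

locale knapsack_ram = knapsack +
  fixes b :: nat and X :: int
  assumes X_ge: "40 \<le> X" and X_bit: "1000 * X < 2 ^ b"
    and n_X: "int n \<le> X" and W_X: "int W \<le> X" and w_X: "int (\<Sum>i<n. w i) \<le> X" and p_X: "int (\<Sum>i<n. p i) \<le> X"
    and K_X: "int K \<le> X" and Kcap_X: "int K * int cap \<le> X" and KK_X: "int K * int K \<le> 4 * X"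
    and dev_X: "int dev \<le> 16 * X"
begin

lemma big: "40 < (2 :: int) ^ b"
  using X_ge X_bit by linarith

lemma fits_X: "\<bar>v\<bar> \<le> 1000 * X \<Longrightarrow> fits b v"
  using X_bit by (simp add: fits_def)

lemma w_i_X: "i < n \<Longrightarrow> int (w i) \<le> X"
  using w_le_wm[of i] wm_le_sum w_X by linarith

lemma p_i_X: "i < n \<Longrightarrow> int (p i) \<le> X"
  using member_le_sum[of i "{..<n}" p] p_X by (simp del: of_nat_sum)

lemma cap_X: "int cap \<le> X"
  using W_X by (simp add: cap_def del: of_nat_sum)

lemma m_less_K: "m < K"
  by (simp add: K_def)

definition input :: "(int \<Rightarrow> int) \<Rightarrow> bool" where
  "input M \<longleftrightarrow> M rZero = 0 \<and> M rOne = 1 \<and> M 0 = int n \<and>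
    (\<forall>i<n. M (2 * int i + 2) = int (w i) \<and> M (2 * int i + 3) = int (p i))"

definition regs :: "(int \<Rightarrow> int) \<Rightarrow> bool" where
  "regs M \<longleftrightarrow> input M \<and> M rCap = int cap \<and> M rMax = int wm \<and> M rK = int K \<and> M rM = int m \<and>
    M rDev = int dev \<and> M rBase = 2 * int n + 2 \<and> M rKeys = - 40"

text \<open>The table has no upper end: zero memory above the input already is the initial table, at
  no cost.\<close>

definition table :: "(nat \<Rightarrow> nat) \<Rightarrow> (int \<Rightarrow> int) \<Rightarrow> bool" where
  "table F M \<longleftrightarrow> (\<forall>j. M (2 * int n + 2 + int j) = int (F j))"

definition stored :: "(nat \<Rightarrow> nat) \<Rightarrow> (int \<Rightarrow> int) \<Rightarrow> bool" where
  "stored key M \<longleftrightarrow> (\<forall>i<n. M (- 41 - int i) = int (key i))"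

section \<open>The dynamic program on the machine\<close>

text \<open>Weights are positive and entries are treated downwards, so \<open>F (j - w i)\<close> is
  still the old value when entry \<open>j\<close> is overwritten; updating in place thus agrees with
  \<open>relax\<close>. Once \<open>j\<close> is below \<open>l\<close> or \<open>w i\<close>, no
  smaller entry can change. An entry costs at most 13 steps, the exit at most 5.\<close>

lemma inner_loop:
  assumes i: "i < n" and F: "\<And>j. F j + p i \<le> (\<Sum>i<n. p i)" and h: "h \<le> 20 * X" and l: "\<bar>l\<bar> \<le> 20 * X"
    and "regs M" "stored key M" "M rLo = 2 * int n + 2 + l" "M rW = int (w i)" "M rP = int (p i)"
      "M rA = 2 * int n + 2 + int j" "int j \<le> h"
      "table (\<lambda>k. if k > j then relax l h (w i) (p i) F k else F k) M"
  shows "\<exists>M'. reach b (13 * nat (int j - l + 1) + 5) (Run 69 M) (Run 82 M') \<and> regs M' \<and> stored key M' \<and>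
    table (relax l h (w i) (p i) F) M' \<and> M' rI = M rI \<and> M' rQ = M rQ \<and> M' rLo = M rLo \<and> M' rHi = M rHi"
  using assms(5-)
proof (induction j arbitrary: M rule: less_induct)
  case (less j)
  note bnds = X_ge n_X w_i_X[OF i] p_i_X[OF i] h l less.prems(7)
  have Mz: "M rZero = 0" "M rOne = 1" "M rBase = 2 * int n + 2"
    using less.prems(1) by (auto simp: regs_def input_def)
  show ?case
  proof (cases "l \<le> int j \<and> w i \<le> j")
    case False
    have "relax l h (w i) (p i) F k = F k" if "k \<le> j" for k using that False by (auto simp: relax_def)
    then have eq: "(\<lambda>k. if k > j then relax l h (w i) (p i) F k else F k) = relax l h (w i) (p i) F"
      by (auto simp: fun_eq_iff)
    define M1 where "M1 = (if int j < l then M(rT := int j - l)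
      else M(rT := int j - int (w i), rC := 2 * int n + 2 + int j - int (w i)))"
    have "reach b 5 (Run 69 M) (Run 82 M1)"
    proof (cases "int j < l")
      case True
      have "steps b 2 (Run 69 M) (Run 82 M1)"
        using less.prems True Mz bnds big by (simp add: exec_simps fits_X M1_def)
      then show ?thesis by (rule reach_steps) simp
    next
      case F2: False
      have "steps b 5 (Run 69 M) (Run 82 M1)"
        using less.prems False F2 Mz bnds big by (auto simp add: exec_simps fits_X M1_def fun_eq_iff)
      then show ?thesis by (rule reach_steps) simp
    qed
    then have "reach b (13 * nat (int j - l + 1) + 5) (Run 69 M) (Run 82 M1)" by (rule reach_mono) simp
    moreover have "regs M1" "stored key M1" using less.prems by (auto simp: regs_def input_def M1_def stored_def)
    moreover have "table (relax l h (w i) (p i) F) M1" using less.prems(8) unfolding eq by (auto simp: table_def M1_def)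
    ultimately show ?thesis by (intro exI[of _ M1]) (auto simp: M1_def)
  next
    case True
    define x where "x = F j"
    define y where "y = F (j - w i)"
    define A where "A = 2 * int n + 2 + int j"
    have wj: "0 < int (w i)" "int (w i) \<le> int j" using True w_pos[OF i] by auto
    have Mk: "M (2 * int n + 2 + int k) = int (if k > j then relax l h (w i) (p i) F k else F k)" for k
      using less.prems(8) by (simp add: table_def)
    have Mx: "M A = int x"
      using Mk[of j] by (simp add: x_def A_def)
    have My: "M (A - int (w i)) = int y"
      using Mk[of "j - w i"] wj by (simp add: y_def A_def of_nat_diff algebra_simps split: if_splits)
    have xy: "int x \<le> X" "int y + int (p i) \<le> X"
      using F[of j] F[of "j - w i"] p_X by (auto simp: x_def y_def simp del: of_nat_sum)
    define M1 where "M1 = M(rT := int y + int (p i) - int x, rC := A - int (w i), rY := int y + int (p i), rX := int x,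
      A := max (int x) (int y + int (p i)), rA := A - 1)"
    have A: "0 \<le> A" "0 \<le> A - int (w i)" using wj by (auto simp: A_def)
    have "steps b (if int y + int (p i) < int x then 12 else 13) (Run 69 M) (Run 69 M1)"
      unfolding M1_def
      by (rule exec_relax[where L = "2 * int n + 2 + l" and B = "2 * int n + 2" and y = "int y" and v = "int (w i)" and u = "int (p i)"])
        (use Mz Mx My less.prems A True xy bnds wj big in \<open>auto simp: A_def intro!: fits_X\<close>)
    then have r1: "reach b 13 (Run 69 M) (Run 69 M1)" by (rule reach_steps) auto
    have "table (\<lambda>k. if k > j - 1 then relax l h (w i) (p i) F k else F k) M1"
      unfolding table_def
    proof
      fix k
      show "M1 (2 * int n + 2 + int k) = int (if k > j - 1 then relax l h (w i) (p i) F k else F k)"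
      proof (cases "k = j")
        case True
        then show ?thesis using \<open>l \<le> int j \<and> w i \<le> j\<close> less.prems(7) wj
          by (auto simp: M1_def A_def relax_def x_def y_def)
      next
        case False
        then show ?thesis using Mk[of k] by (auto simp: M1_def A_def)
      qed
    qed
    moreover have "regs M1" "stored key M1" using less.prems by (auto simp: regs_def input_def M1_def stored_def A_def)
    moreover have M1: "M1 rLo = M rLo" "M1 rW = M rW" "M1 rP = M rP" "M1 rI = M rI" "M1 rQ = M rQ" "M1 rHi = M rHi"
      "M1 rA = 2 * int n + 2 + int (j - 1)"
      using wj A by (auto simp: M1_def A_def of_nat_diff)
    ultimately have "\<exists>M'. reach b (13 * nat (int (j - 1) - l + 1) + 5) (Run 69 M1) (Run 82 M') \<and> regs M' \<and> stored key M' \<and>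
      table (relax l h (w i) (p i) F) M' \<and> M' rI = M1 rI \<and> M' rQ = M1 rQ \<and> M' rLo = M1 rLo \<and> M' rHi = M1 rHi"
      using less.prems(3-7) wj by (intro less.IH) auto
    then obtain M' where M': "reach b (13 * nat (int (j - 1) - l + 1) + 5) (Run 69 M1) (Run 82 M')"
      "regs M'" "stored key M'" "table (relax l h (w i) (p i) F) M'"
      "M' rI = M rI" "M' rQ = M rQ" "M' rLo = M rLo" "M' rHi = M rHi"
      using M1 by auto
    have "13 + (13 * nat (int (j - 1) - l + 1) + 5) \<le> 13 * nat (int j - l + 1) + 5"
      using True wj by (simp add: of_nat_diff nat_add_distrib)
    then have "reach b (13 * nat (int j - l + 1) + 5) (Run 69 M) (Run 82 M')"
      using reach_trans[OF r1 M'(1)] reach_mono by blast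
    then show ?thesis using M' by blast
  qed
qed

text \<open>One of the two extra units is for rounding the quotients, the other for counting both
  ends of the window.\<close>

definition width :: nat where
  "width = cap div K + wm + 2 * dev + 2"

lemma window_bounds:
  assumes "q < K"
  shows "int (q * cap div K) \<le> X" "int ((q + 1) * cap div K) \<le> X" "\<bar>lo q\<bar> \<le> 20 * X" "hi q \<le> 20 * X" "0 \<le> hi q"
    "nat (hi q - lo q + 1) \<le> width"
proof -
  have *: "int (r * cap) \<le> X" if "r \<le> K" for r
  proof -
    have "int r * int cap \<le> int K * int cap" using that by (intro mult_right_mono) auto
    then show ?thesis using Kcap_X by simp
  qed
  have **: "int (r * cap div K) \<le> int (r * cap)" for r
    by (simp del: of_nat_mult)
  show 1: "int (q * cap div K) \<le> X" and 2: "int ((q + 1) * cap div K) \<le> X"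
    using *[of q] **[of q] *[of "q + 1"] **[of "q + 1"] assms by linarith+
  have wm: "int wm \<le> X" using wm_le_sum w_X by linarith
  show "\<bar>lo q\<bar> \<le> 20 * X" "hi q \<le> 20 * X" "0 \<le> hi q"
    using 1 2 wm dev_X X_ge unfolding lo_def hi_def by linarith+
  \<comment> \<open>Two remainders modulo \<open>K\<close> add up to less than \<open>2 * K\<close>,
    so rounding costs at most one.\<close>
  have "(q + 1) * cap div K \<le> q * cap div K + cap div K + 1"
    using K_pos div_add1_eq[of "q * cap" cap K] by (simp add: algebra_simps div_le_mono2) (smt (verit) add_less_mono div_less_iff_less_mult less_Suc_eq_le mod_less_divisor mult_2 numeral_2_eq_2)
  then show "nat (hi q - lo q + 1) \<le> width" unfolding lo_def hi_def width_def by linarith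
qed

text \<open>Only items with key \<open>q\<close> pay for a window, the others a constant. Soundness
  is carried along because it keeps the table values within a word.\<close>

lemma item_loop:
  assumes q: "q < K" and key: "\<And>i. key i < K"
  shows "i \<le> n \<Longrightarrow> regs M \<Longrightarrow> stored key M \<Longrightarrow> M rI = int i \<Longrightarrow> M rQ = int q \<Longrightarrow>
    M rLo = 2 * int n + 2 + lo q \<Longrightarrow> M rHi = 2 * int n + 2 + hi q \<Longrightarrow> table F M \<Longrightarrow> sound (processed key q i) F \<Longrightarrow>
    \<exists>M'. reach b (1 + (\<Sum>k<i. 8 + of_bool (key k = q) * (13 * width + 10))) (Run 58 M) (Run 84 M') \<and>
      regs M' \<and> stored key M' \<and> table (phase key q i F) M' \<and> M' rQ = int q"
proof (induction i arbitrary: M F)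
  case 0
  have "steps b 1 (Run 58 M) (Run 84 M)" using 0 by (simp add: exec_simps)
  then show ?case using 0 by (auto intro: reach_steps)
next
  case (Suc i)
  have i: "i < n" using Suc.prems by simp
  note bnds = X_ge n_X w_i_X[OF i] p_i_X[OF i] K_X window_bounds[OF q]
  have Mz: "M rZero = 0" "M rOne = 1" "M rBase = 2 * int n + 2" "M rKeys = - 40"
    "M (2 * int i + 2) = int (w i)" "M (2 * int i + 3) = int (p i)"
    using Suc.prems(2) i by (auto simp: regs_def input_def)
  have Mkey: "M (- 41 - int i) = int (key i)" using Suc.prems(3) i by (simp add: stored_def)
  moreover have "- int i - 41 = - 41 - int i" by simp
  ultimately have Mkey': "M (- int i - 41) = int (key i)" by presburger
  have keyX: "int (key i) \<le> X" "int q \<le> X" "int i \<le> X" using key[of i] q i bnds by linarith+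
  define G where "G = (if key i = q then relax (lo q) (hi q) (w i) (p i) F else F)"
  have G: "sound (processed key q i) G"
    using Suc.prems(9) sound_insert[OF Suc.prems(9) _ finite_processed] not_in_processed[of i key q] processed_step[OF i, of key q]
    by (auto simp: G_def)
  have "\<exists>M1. reach b (6 + of_bool (key i = q) * (13 * width + 10)) (Run 58 M) (Run 82 M1) \<and> regs M1 \<and> stored key M1 \<and> table G M1 \<and>
    M1 rI = M rI \<and> M1 rQ = M rQ \<and> M1 rLo = M rLo \<and> M1 rHi = M rHi"
  proof (cases "key i = q")
    case False
    define M1 where "M1 = M(rA := - 41 - int i, rT := int (key i) - int q)"
    have "steps b 6 (Run 58 M) (Run 82 (M(rA := - 40 - int (Suc i), rT := int (key i) - int q)))"
      by (rule exec_skip) (use Mz Mkey Suc.prems False bnds keyX big in \<open>auto intro!: fits_X\<close>)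
    then have "reach b 6 (Run 58 M) (Run 82 M1)" by (intro reach_steps) (auto simp: M1_def)
    moreover have "regs M1" "stored key M1" "table G M1"
      using Suc.prems(2,3,8) False by (auto simp: M1_def regs_def input_def stored_def table_def G_def)
    ultimately show ?thesis using False by (intro exI[of _ M1]) (auto simp: M1_def)
  next
    case True
    define M1 where "M1 = M(rT := 0, rW := int (w i), rP := int (p i), rA := 2 * int n + 2 + hi q)"
    have "steps b 10 (Run 58 M) (Run 69 M1)" unfolding M1_def
      by (rule exec_fetch[where i = "int (Suc i)" and q = "int q"])
        (use Mz Mkey Mkey' Suc.prems True bnds keyX big in \<open>auto intro!: fits_X simp: algebra_simps\<close>)
    then have r1: "reach b 10 (Run 58 M) (Run 69 M1)" by (rule reach_steps) simp
    have M1: "regs M1" "stored key M1" "table F M1"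
      using Suc.prems(2,3,8) by (auto simp: M1_def regs_def input_def stored_def table_def)
    \<comment> \<open>\<open>relax\<close> changes nothing above the window, so the invariant of the
      inner loop holds on entry at \<open>hi q\<close>.\<close>
    have eq: "(\<lambda>k. if k > nat (hi q) then relax (lo q) (hi q) (w i) (p i) F k else F k) = F"
      using window_bounds(5)[OF q] by (auto simp: fun_eq_iff relax_def)
    have "F j + p i \<le> (\<Sum>i<n. p i)" for j
      using sound_bound[OF Suc.prems(9) processed_subset i] not_in_processed[of i key q] True by blast
    then have "\<exists>M'. reach b (13 * nat (int (nat (hi q)) - lo q + 1) + 5) (Run 69 M1) (Run 82 M') \<and> regs M' \<and> stored key M' \<and>
      table (relax (lo q) (hi q) (w i) (p i) F) M' \<and> M' rI = M1 rI \<and> M' rQ = M1 rQ \<and> M' rLo = M1 rLo \<and> M' rHi = M1 rHi"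
      using M1 window_bounds[OF q] Suc.prems(6) by (intro inner_loop[OF i]) (auto simp: eq, auto simp: M1_def)
    then obtain M2 where M2: "reach b (13 * nat (int (nat (hi q)) - lo q + 1) + 5) (Run 69 M1) (Run 82 M2)" "regs M2" "stored key M2"
      "table G M2" "M2 rI = M rI" "M2 rQ = M rQ" "M2 rLo = M rLo" "M2 rHi = M rHi"
      using True by (auto simp: M1_def G_def)
    have "10 + (13 * nat (int (nat (hi q)) - lo q + 1) + 5) \<le> 6 + of_bool (key i = q) * (13 * width + 10)"
      using window_bounds(5,6)[OF q] True by simp
    then show ?thesis using reach_mono[OF reach_trans[OF r1 M2(1)]] M2 by blast
  qed
  then obtain M1 where M1: "reach b (6 + of_bool (key i = q) * (13 * width + 10)) (Run 58 M) (Run 82 M1)" "regs M1" "stored key M1" "table G M1"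
    "M1 rI = int (Suc i)" "M1 rQ = int q" "M1 rLo = 2 * int n + 2 + lo q" "M1 rHi = 2 * int n + 2 + hi q"
    using Suc.prems by auto
  define M2 where "M2 = M1(rI := int i)"
  have "steps b 2 (Run 82 M1) (Run 58 M2)"
    using M1(2,5) big keyX X_ge by (simp add: exec_simps regs_def input_def fits_X M2_def)
  then have r2: "reach b 2 (Run 82 M1) (Run 58 M2)" by (rule reach_steps) simp
  have "\<exists>M'. reach b (1 + (\<Sum>k<i. 8 + of_bool (key k = q) * (13 * width + 10))) (Run 58 M2) (Run 84 M') \<and>
      regs M' \<and> stored key M' \<and> table (phase key q i G) M' \<and> M' rQ = int q"
    by (rule Suc.IH) (use i G M1 in \<open>auto simp: M2_def regs_def input_def stored_def table_def\<close>)
  then obtain M' where M': "reach b (1 + (\<Sum>k<i. 8 + of_bool (key k = q) * (13 * width + 10))) (Run 58 M2) (Run 84 M')"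
      "regs M'" "stored key M'" "table (phase key q i G) M'" "M' rQ = int q" by blast
  have "reach b (1 + (\<Sum>k<Suc i. 8 + of_bool (key k = q) * (13 * width + 10))) (Run 58 M) (Run 84 M')"
    by (rule reach_mono[OF reach_trans[OF reach_trans[OF M1(1) r2] M'(1)]]) simp
  then show ?case using M' by (auto simp: G_def)
qed

lemma phase_loop:
  assumes key: "\<And>i. key i < K" and M0: "regs M0" "stored key M0" "table (\<lambda>_. 0) M0" "M0 rQ = 0"
  shows "q \<le> K \<Longrightarrow> \<exists>M. reach b (\<Sum>r<q. 16 + (\<Sum>k<n. 8 + of_bool (key k = r) * (13 * width + 10))) (Run 45 M0) (Run 45 M) \<and>
    regs M \<and> stored key M \<and> table (dp key q) M \<and> M rQ = int q"
proof (induction q)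
  case 0
  then show ?case using M0 by (auto intro: reach_refl)
next
  case (Suc q)
  have q: "q < K" using Suc.prems by simp
  obtain M where M: "reach b (\<Sum>r<q. 16 + (\<Sum>k<n. 8 + of_bool (key k = r) * (13 * width + 10))) (Run 45 M0) (Run 45 M)"
    "regs M" "stored key M" "table (dp key q) M" "M rQ = int q" using Suc by auto
  define M1 where "M1 = M(rT := int q + 1, rLo := 2 * int n + 2 + lo q, rHi := 2 * int n + 2 + hi q, rI := int n)"
  note bnds = X_ge n_X K_X window_bounds[OF q] dev_X
  have wmX: "int wm \<le> X" using wm_le_sum w_X by linarith
  have c1: "int q * int cap \<le> X" "(int q + 1) * int cap \<le> X"
    using mult_right_mono[of "int q" "int K" "int cap"] mult_right_mono[of "int q + 1" "int K" "int cap"] q Kcap_X by simp_all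
  have e: "int q * int cap div int K = int (q * cap div K)" "(int q + 1) * int cap div int K = int ((q + 1) * cap div K)"
    by (simp_all add: zdiv_int algebra_simps)
  have "steps b 13 (Run 45 M) (Run 58 (M(rT := int q + 1, rLo := int q * int cap div int K - int dev + (2 * int n + 2),
      rHi := (int q + 1) * int cap div int K + int dev + int wm + (2 * int n + 2), rI := int n)))"
    by (rule exec_window) (use M(2,5) q bnds wmX c1 big in \<open>auto simp: regs_def input_def e simp del: of_nat_div intro!: fits_X\<close>)
  moreover have "M(rT := int q + 1, rLo := int q * int cap div int K - int dev + (2 * int n + 2),
      rHi := (int q + 1) * int cap div int K + int dev + int wm + (2 * int n + 2), rI := int n) = M1"
    unfolding e M1_def lo_def hi_def by (simp add: algebra_simps)
  ultimately have r1: "reach b 13 (Run 45 M) (Run 58 M1)" by (auto intro: reach_steps)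
  have "\<exists>M'. reach b (1 + (\<Sum>k<n. 8 + of_bool (key k = q) * (13 * width + 10))) (Run 58 M1) (Run 84 M') \<and>
      regs M' \<and> stored key M' \<and> table (phase key q n (dp key q)) M' \<and> M' rQ = int q"
    by (rule item_loop[OF q key])
      (use M sound_dp[of key q] in \<open>auto simp: M1_def regs_def input_def stored_def table_def\<close>)
  then obtain M2 where M2: "reach b (1 + (\<Sum>k<n. 8 + of_bool (key k = q) * (13 * width + 10))) (Run 58 M1) (Run 84 M2)"
      "regs M2" "stored key M2" "table (dp key (Suc q)) M2" "M2 rQ = int q" by auto
  define M3 where "M3 = M2(rQ := int q + 1)"
  have "steps b 2 (Run 84 M2) (Run 45 M3)"
    using M2 q bnds big by (simp add: exec_simps regs_def input_def fits_X M3_def)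
  then have r3: "reach b 2 (Run 84 M2) (Run 45 M3)" by (rule reach_steps) simp
  \<comment> \<open>16 is 13 for the window, 1 for leaving the item loop and 2 for advancing
    \<open>q\<close>.\<close>
  have "reach b (\<Sum>r<Suc q. 16 + (\<Sum>k<n. 8 + of_bool (key k = r) * (13 * width + 10))) (Run 45 M0) (Run 45 M3)"
    by (rule reach_mono[OF reach_trans[OF M(1) reach_trans[OF r1 reach_trans[OF M2(1) r3]]]]) simp
  moreover have "regs M3" "stored key M3" "table (dp key (Suc q)) M3" "M3 rQ = int (Suc q)"
    using M2(2-4) by (auto simp: M3_def regs_def input_def stored_def table_def)
  ultimately show ?case by blast
qed

text \<open>After exchanging the sums, each item has exactly one phase that pays for its window:
  \<open>n\<close> windows in total instead of \<open>n * K\<close>. Testing every key in every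
  phase gives \<open>8 * n * K\<close>.\<close>

lemma run_dp:
  assumes key: "\<And>i. key i < K" and M0: "regs M0" "stored key M0" "table (\<lambda>_. 0) M0" "M0 rQ = 0"
  shows "reach b (16 * K + 8 * n * K + n * (13 * width + 10) + 5) (Run 45 M0) (Done (int (dp key K cap)))"
proof -
  obtain M where M: "reach b (\<Sum>r<K. 16 + (\<Sum>k<n. 8 + of_bool (key k = r) * (13 * width + 10))) (Run 45 M0) (Run 45 M)"
    "regs M" "table (dp key K) M" "M rQ = int K" using phase_loop[OF assms, of K] by auto
  obtain S where "S \<subseteq> {..<n}" "sum p S = dp key K cap"
    using sound_dp[of key K] processed_subset[of key K n] unfolding sound_def by (meson subset_trans)
  then have "dp key K cap \<le> (\<Sum>i<n. p i)" using sum_mono2[of "{..<n}" S p] by simp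
  then have v: "int (dp key K cap) \<le> X" using p_X by linarith
  have "steps b 5 (Run 45 M) (Done (int (dp key K cap)))"
    by (rule exec_finish[where r = "2 * int n + 2" and c = "int cap"])
      (use M(2-4) v X_ge n_X cap_X big in \<open>auto simp: regs_def table_def intro!: fits_X\<close>)
  then have "reach b 5 (Run 45 M) (Done (int (dp key K cap)))" by (rule reach_steps) simp
  from reach_trans[OF M(1) this]
  have "reach b ((\<Sum>r<K. 16 + (\<Sum>k<n. 8 + of_bool (key k = r) * (13 * width + 10))) + 5) (Run 45 M0) (Done (int (dp key K cap)))" .
  moreover have "(\<Sum>r<K. 16 + (\<Sum>k<n. 8 + of_bool (key k = r) * (13 * width + 10))) = 16 * K + 8 * n * K + n * (13 * width + 10)"
  proof -
    have "(\<Sum>r<K. of_bool (key k = r) * (13 * width + 10)) = 13 * width + 10" for k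
      using key[of k] by (simp add: of_bool_def if_distrib[of "\<lambda>x. x * _"] cong: if_cong)
    then have "(\<Sum>r<K. \<Sum>k<n. of_bool (key k = r) * (13 * width + 10)) = n * (13 * width + 10)"
      by (subst sum.swap) simp
    then show ?thesis by (simp add: sum.distrib)
  qed
  ultimately show ?thesis by simp
qed

section \<open>Generating the keys\<close>

text \<open>The bound \<open>(acc + 1) * 2 ^ k \<le> K\<close> is preserved when a bit is appended
  and keeps every intermediate key within a word.\<close>

lemma bit_loop:
  "length x = 6 * k \<Longrightarrow> M rZero = 0 \<Longrightarrow> M rOne = 1 \<Longrightarrow> M rJ = int k \<Longrightarrow> M rKey = int acc \<Longrightarrow> (acc + 1) * 2 ^ k \<le> K \<Longrightarrow>
    k \<le> K \<Longrightarrow> \<exists>M'. foldl (step prog b) (Run 35 M) x = Run 35 M' \<and> M' rJ = 0 \<and> M' rKey = int (read_key k x acc) \<and>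
      (\<forall>a. a \<notin> {rR, rKey, rJ} \<longrightarrow> M' a = M a)"
proof (induction k arbitrary: M x acc)
  case 0
  then show ?case by (intro exI[of _ M]) auto
next
  case (Suc k)
  then obtain c0 c1 c2 c3 c4 c5 y where x: "x = [c0, c1, c2, c3, c4, c5] @ y" and y: "length y = 6 * k"
    by (auto simp: length_Suc_conv numeral_eq_Suc)
  have "2 * (acc + 1) * 1 \<le> 2 * (acc + 1) * 2 ^ k" by (intro mult_le_mono2) simp
  then have acc: "2 * (acc + 1) \<le> K" using Suc.prems(6) by (simp add: algebra_simps)
  define M1 where "M1 = M(rR := of_bool c1, rKey := int acc + int acc + of_bool c1, rJ := int (Suc k) - 1)"
  have "foldl (step prog b) (Run 35 M) [c0, c1, c2, c3, c4, c5] = Run 35 M1" unfolding M1_def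
    by (rule exec_bit) (use Suc.prems big acc K_X X_ge in \<open>auto simp: of_bool_def intro!: fits_X\<close>)
  moreover have "\<exists>M'. foldl (step prog b) (Run 35 M1) y = Run 35 M' \<and> M' rJ = 0 \<and>
      M' rKey = int (read_key k y (2 * acc + of_bool c1)) \<and> (\<forall>a. a \<notin> {rR, rKey, rJ} \<longrightarrow> M' a = M1 a)"
  proof (rule Suc.IH[OF y])
    have "(2 * acc + of_bool c1 + 1) * 2 ^ k \<le> (2 * acc + 2) * 2 ^ k" by (intro mult_right_mono) auto
    also have "\<dots> \<le> K" using Suc.prems(6) by (simp add: algebra_simps)
    finally show "(2 * acc + of_bool c1 + 1) * 2 ^ k \<le> K" .
  qed (use Suc.prems in \<open>auto simp: M1_def\<close>)
  ultimately show ?case unfolding x foldl_append by (auto simp: M1_def)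
qed

lemma key_block:
  assumes M: "regs M" "M rI = int (Suc i)" and i: "i < n" and cs: "length cs = 6 * m + 8"
  shows "\<exists>M'. foldl (step prog b) (Run 32 M) cs = Run 32 M' \<and> regs M' \<and> M' rI = int i \<and>
    M' (- 41 - int i) = int (block_key m cs) \<and>
    (\<forall>a. a \<notin> {rI, rA, rR, rKey, rJ, - 41 - int i} \<longrightarrow> M' a = M a)"
proof -
  define y where "y = drop 3 (take (6 * m + 3) cs)"
  have split: "cs = take 3 cs @ y @ drop (6 * m + 3) cs"
    unfolding y_def append_assoc[symmetric] by (metis append_take_drop_id take_add add.commute drop_take add_diff_cancel_right')
  have y: "length y = 6 * m" using cs by (simp add: y_def)
  have mX: "int m \<le> X" using m_less_K K_X by linarith
  have Mr: "M rZero = 0" "M rOne = 1" "M rM = int m" "M rKeys = - 40" using M(1) by (auto simp: regs_def input_def)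
  define M1 where "M1 = M(rKey := 0, rJ := int m)"
  have "steps b 3 (Run 32 M) (Run 35 M1)" unfolding M1_def
    by (rule exec_key_start) (use M(2) Mr mX X_ge big in \<open>auto intro!: fits_X\<close>)
  then have f1: "foldl (step prog b) (Run 32 M) (take 3 cs) = Run 35 M1" using cs by (simp add: steps_def)
  have "\<exists>M'. foldl (step prog b) (Run 35 M1) y = Run 35 M' \<and> M' rJ = 0 \<and> M' rKey = int (read_key m y 0) \<and>
      (\<forall>a. a \<notin> {rR, rKey, rJ} \<longrightarrow> M' a = M1 a)"
    by (rule bit_loop[OF y]) (use Mr m_less_K in \<open>auto simp: M1_def K_def\<close>)
  then obtain M2 where M2: "foldl (step prog b) (Run 35 M1) y = Run 35 M2" "M2 rJ = 0" "M2 rKey = int (block_key m cs)"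
    "\<And>a. a \<notin> {rR, rKey, rJ} \<Longrightarrow> M2 a = M a" by (auto simp: block_key_def y_def M1_def)
  have "block_key m cs < K"
    using read_key_less[of m "drop 3 (take (6 * m + 3) cs)" 0] by (simp add: block_key_def K_def)
  then have kX: "int (block_key m cs) \<le> X" using K_X by linarith
  define M3 where "M3 = M2(rA := - 40 - int (Suc i), - 40 - int (Suc i) := int (block_key m cs), rI := int (Suc i) - 1)"
  have "steps b 5 (Run 35 M2) (Run 32 M3)" unfolding M3_def
    by (rule exec_key_store) (use M2 M Mr X_ge n_X i kX big in \<open>auto intro!: fits_X\<close>)
  then have "foldl (step prog b) (Run 35 M2) (drop (6 * m + 3) cs) = Run 32 M3" using cs by (simp add: steps_def)
  then have "foldl (step prog b) (Run 32 M) cs = Run 32 M3"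
    by (subst split) (simp only: foldl_append f1 M2(1))
  moreover have fr: "M3 a = M a" if "a \<notin> {rI, rA, rR, rKey, rJ, - 41 - int i}" for a
    using that M2(4)[of a] by (auto simp: M3_def)
  moreover have "regs M3" using M(1) fr unfolding regs_def input_def by simp
  ultimately show ?thesis by (intro exI[of _ M3]) (auto simp: M3_def)
qed

text \<open>Keys of higher indices are stored first, and the frame condition at and below
  \<open>- 41 - int i\<close> preserves them. The one extra coin is spent on the exit test.\<close>

lemma key_loop:
  "i \<le> n \<Longrightarrow> regs M \<Longrightarrow> M rI = int i \<Longrightarrow> length cs = i * (6 * m + 8) + 1 \<Longrightarrow>
   \<exists>M'. foldl (step prog b) (Run 32 M) cs = Run 45 M' \<and> regs M' \<and>
     (\<forall>k<i. M' (- 41 - int k) = int (keys m i cs k)) \<and>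
     (\<forall>a. 0 \<le> a \<or> a = rQ \<or> a \<le> - 41 - int i \<longrightarrow> M' a = M a)"
proof (induction i arbitrary: M cs)
  case 0
  then obtain c where "cs = [c]" by (auto simp: length_Suc_conv)
  then show ?case using 0 by (simp add: exec_simps)
next
  case (Suc i)
  let ?L = "6 * m + 8"
  obtain M1 where M1: "foldl (step prog b) (Run 32 M) (take ?L cs) = Run 32 M1" "regs M1" "M1 rI = int i"
    "M1 (- 41 - int i) = int (block_key m (take ?L cs))"
    "\<And>a. a \<notin> {rI, rA, rR, rKey, rJ, - 41 - int i} \<Longrightarrow> M1 a = M a"
    using key_block[of M i "take ?L cs"] Suc.prems by auto
  have "\<exists>M'. foldl (step prog b) (Run 32 M1) (drop ?L cs) = Run 45 M' \<and> regs M' \<and>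
     (\<forall>k<i. M' (- 41 - int k) = int (keys m i (drop ?L cs) k)) \<and>
     (\<forall>a. 0 \<le> a \<or> a = rQ \<or> a \<le> - 41 - int i \<longrightarrow> M' a = M1 a)"
    by (rule Suc.IH) (use Suc.prems M1 in auto)
  then obtain M' where M': "foldl (step prog b) (Run 32 M1) (drop ?L cs) = Run 45 M'" "regs M'"
     "\<And>k. k < i \<Longrightarrow> M' (- 41 - int k) = int (keys m i (drop ?L cs) k)"
     "\<And>a. 0 \<le> a \<or> a = rQ \<or> a \<le> - 41 - int i \<Longrightarrow> M' a = M1 a" by blast
  have "foldl (step prog b) (Run 32 M) cs = Run 45 M'"
    using foldl_append[of "step prog b" "Run 32 M" "take ?L cs" "drop ?L cs"] M1(1) M'(1) by simp
  moreover have "M' (- 41 - int k) = int (keys m (Suc i) cs k)" if "k < Suc i" for k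
    using that M'(3)[of k] M'(4)[of "- 41 - int i"] M1(4) by (cases "k = i") auto
  moreover have "M' a = M a" if "0 \<le> a \<or> a = rQ \<or> a \<le> - 41 - int (Suc i)" for a
    using that M'(4)[of a] M1(5)[of a] by auto
  ultimately show ?case using M'(2) by blast
qed

section \<open>The deterministic setup\<close>

text \<open>The scan runs from the last item to the first; \<open>insert 0\<close> reflects that
  \<open>rMax\<close> starts from zeroed memory.\<close>

lemma scan_loop:
  "i \<le> n \<Longrightarrow> input M \<Longrightarrow> M rI = int i \<Longrightarrow> M rCap = int (\<Sum>k=i..<n. w k) \<Longrightarrow> M rMax = int (Max (insert 0 (w ` {i..<n}))) \<Longrightarrow>
   \<exists>M'. reach b (9 * i + 1) (Run 2 M) (Run 11 M') \<and> input M' \<and> M' rCap = int (\<Sum>k<n. w k) \<and> M' rMax = int wm \<and>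
     (\<forall>a. 0 \<le> a \<or> a < - 8 \<longrightarrow> M' a = M a)"
proof (induction i arbitrary: M)
  case 0
  have "steps b 1 (Run 2 M) (Run 11 M)" using 0 by (simp add: exec_simps)
  then have "reach b (9 * 0 + 1) (Run 2 M) (Run 11 M)" by (rule reach_steps) simp
  moreover have "Max (insert 0 (w ` {0..<n})) = wm"
  proof (rule antisym)
    show "Max (insert 0 (w ` {0..<n})) \<le> wm" using w_le_wm by auto
    obtain i where "i < n" "wm = w i" using wm_attained by blast
    then show "wm \<le> Max (insert 0 (w ` {0..<n}))" by (intro Max_ge) auto
  qed
  ultimately show ?case using 0 by (auto simp: atLeast0LessThan)
next
  case (Suc i)
  have i: "i < n" using Suc.prems by simp
  let ?c = "\<Sum>k=Suc i..<n. w k" and ?x = "Max (insert 0 (w ` {Suc i..<n}))"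
  have Mz: "M rZero = 0" "M rOne = 1" "M (2 * int i + 2) = int (w i)"
    using Suc.prems(2) i by (auto simp: input_def)
  then have Mz': "M (2 + 2 * int i) = int (w i)" by (simp only: add.commute)
  have ivl: "{i..<n} = insert i {Suc i..<n}" using i by auto
  have c: "w i + ?c = (\<Sum>k=i..<n. w k)" unfolding ivl by simp
  then have cI: "int ?c + int (w i) = int (\<Sum>k=i..<n. w k)" by linarith
  have x: "max ?x (w i) = Max (insert 0 (w ` {i..<n}))" unfolding ivl by (simp add: insert_commute[of 0] max.commute max.assoc)
  have "(\<Sum>k=i..<n. w k) \<le> (\<Sum>k<n. w k)" by (intro sum_mono2) auto
  then have cX: "int (\<Sum>k=i..<n. w k) \<le> X" using w_X by linarith
  have "?x \<le> wm" using w_le_wm by auto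
  then have xX: "int ?x \<le> X" using wm_le_sum w_X by linarith
  define M1 where "M1 = M(rA := int (Suc i) + int (Suc i), rW := int (w i), rCap := int ?c + int (w i), rT := int (w i) - int ?x,
    rMax := max (int ?x) (int (w i)), rI := int (Suc i) - 1)"
  have "steps b (if int (w i) < int ?x then 8 else 9) (Run 2 M) (Run 2 M1)" unfolding M1_def
    by (rule exec_scan)
     (use Mz Mz' Suc.prems(3-5) big X_ge n_X i xX cX cI w_i_X[OF i] in \<open>auto intro!: fits_X simp del: of_nat_sum\<close>)
  then have r1: "reach b 9 (Run 2 M) (Run 2 M1)" by (rule reach_steps) simp
  have "\<exists>M'. reach b (9 * i + 1) (Run 2 M1) (Run 11 M') \<and> input M' \<and> M' rCap = int (\<Sum>k<n. w k) \<and> M' rMax = int wm \<and>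
     (\<forall>a. 0 \<le> a \<or> a < - 8 \<longrightarrow> M' a = M1 a)"
  proof (rule Suc.IH)
    show "input M1" using Suc.prems(2) by (auto simp: M1_def input_def)
    show "M1 rCap = int (\<Sum>k=i..<n. w k)" "M1 rMax = int (Max (insert 0 (w ` {i..<n})))"
      unfolding c[symmetric] x[symmetric] by (simp_all add: M1_def of_nat_max del: Max_insert)
  qed (use i in \<open>auto simp: M1_def\<close>)
  then obtain M' where M': "reach b (9 * i + 1) (Run 2 M1) (Run 11 M')" "input M'" "M' rCap = int (\<Sum>k<n. w k)" "M' rMax = int wm"
     "\<And>a. 0 \<le> a \<or> a < - 8 \<Longrightarrow> M' a = M1 a" by blast
  have "reach b (9 * Suc i + 1) (Run 2 M) (Run 11 M')" by (rule reach_mono[OF reach_trans[OF r1 M'(1)]]) simp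
  moreover have "M' a = M a" if "0 \<le> a \<or> a < - 8" for a using that M'(5)[of a] by (auto simp: M1_def)
  ultimately show ?case using M' by blast
qed

text \<open>The exit test is the predicate minimised in \<open>bits\<close>, and minimality refutes
  it for every earlier power; so the loop stops exactly at \<open>K\<close>.\<close>

lemma double_loop:
  "k \<le> m \<Longrightarrow> input M \<Longrightarrow> M rK = 2 ^ k \<Longrightarrow> M rM = int k \<Longrightarrow>
   \<exists>M'. reach b (6 * (m - k) + 4) (Run 15 M) (Run 22 M') \<and> input M' \<and> M' rK = int K \<and> M' rM = int m \<and>
     (\<forall>a. a \<notin> {rT, rK, rM} \<longrightarrow> M' a = M a)"
proof (induction "m - k" arbitrary: k M)
  case 0
  then have k: "k = m" by simp
  have KK: "\<not> int K * int K < int n" using n_le_K by (simp add: power2_eq_square flip: of_nat_mult)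
  define M1 where "M1 = M(rT := int K * int K - int n)"
  have "steps b 4 (Run 15 M) (Run 22 M1)" unfolding M1_def
    by (rule exec_double_exit) (use 0 k KK KK_X big X_ge n_X in \<open>auto simp: input_def K_def intro!: fits_X\<close>)
  then have "reach b (6 * (m - k) + 4) (Run 15 M) (Run 22 M1)" by (rule reach_steps) simp
  moreover have "input M1" "M1 rK = int K" "M1 rM = int m" "\<forall>a. a \<notin> {rT, rK, rM} \<longrightarrow> M1 a = M a"
    using 0 k by (auto simp: M1_def input_def K_def)
  ultimately show ?case by blast
next
  case (Suc d)
  then have k: "k < m" by simp
  then have "\<not> n \<le> (2 ^ k)\<^sup>2" unfolding m_def bits_def using not_less_Least by blast
  then have kk: "int (2 ^ k * 2 ^ k) < int n" by (simp only: of_nat_less_iff) (simp add: power2_eq_square)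
  then have kk': "(2 ^ k * 2 ^ k :: int) < int n" by simp
  have "(2 :: nat) ^ Suc k \<le> K" unfolding K_def using k by (intro power_increasing) auto
  then have "int (2 ^ Suc k) \<le> int K" by (simp only: of_nat_le_iff)
  then have k2: "(2 ^ k + 2 ^ k :: int) \<le> X" using K_X by simp
  have "0 \<le> (2 ^ k * 2 ^ k :: int)" by simp
  then have k3: "int n - 2 ^ k * 2 ^ k \<le> 1000 * X" using n_X X_ge by linarith
  have kX: "int k < X" using k m_less_K K_X by linarith
  define M1 where "M1 = M(rT := 2 ^ k * 2 ^ k - int n, rK := 2 ^ k + 2 ^ k, rM := int k + 1)"
  have "steps b 6 (Run 15 M) (Run 15 M1)" unfolding M1_def
    by (rule exec_double) (use Suc.prems kk' k2 k3 kX big X_ge n_X in \<open>auto simp: input_def intro!: fits_X simp: abs_if\<close>)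
  then have r1: "reach b 6 (Run 15 M) (Run 15 M1)" by (rule reach_steps) simp
  have "\<exists>M'. reach b (6 * (m - Suc k) + 4) (Run 15 M1) (Run 22 M') \<and> input M' \<and> M' rK = int K \<and> M' rM = int m \<and>
     (\<forall>a. a \<notin> {rT, rK, rM} \<longrightarrow> M' a = M1 a)"
    by (rule Suc.hyps(1)) (use Suc.hyps(2) Suc.prems k in \<open>auto simp: M1_def input_def\<close>)
  then obtain M' where M': "reach b (6 * (m - Suc k) + 4) (Run 15 M1) (Run 22 M')" "input M'" "M' rK = int K" "M' rM = int m"
     "\<And>a. a \<notin> {rT, rK, rM} \<Longrightarrow> M' a = M1 a" by blast
  have "reach b (6 * (m - k) + 4) (Run 15 M) (Run 22 M')"
    by (rule reach_mono[OF reach_trans[OF r1 M'(1)]]) (use k in simp)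
  moreover have "M' a = M a" if "a \<notin> {rT, rK, rM}" for a using that M'(5)[of a] by (auto simp: M1_def)
  ultimately show ?case using M' by blast
qed

lemma prologue:
  "\<exists>M. reach b (9 * n + 6 * m + 21) (Run 0 (init_mem W items)) (Run 32 M) \<and> regs M \<and> M rI = int n \<and> M rQ = 0 \<and> table (\<lambda>_. 0) M"
proof -
  define M0 where "M0 = init_mem W items"
  have M0: "M0 0 = int n" "M0 1 = int W" "\<And>a. a < 0 \<Longrightarrow> M0 a = 0" "\<And>a. 2 * int n + 2 \<le> a \<Longrightarrow> M0 a = 0"
    "\<And>i. i < n \<Longrightarrow> M0 (2 * int i + 2) = int (w i) \<and> M0 (2 * int i + 3) = int (p i)"
  proof -
    show "M0 0 = int n" "M0 1 = int W" "\<And>a. a < 0 \<Longrightarrow> M0 a = 0" "\<And>a. 2 * int n + 2 \<le> a \<Longrightarrow> M0 a = 0"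
      by (auto simp: M0_def init_mem_def n_def)
    fix i assume "i < n"
    moreover have "(2 * int i + 3 - 2) div 2 = int i" by presburger
    ultimately show "M0 (2 * int i + 2) = int (w i) \<and> M0 (2 * int i + 3) = int (p i)"
      by (auto simp: M0_def init_mem_def n_def w_def p_def)
  qed
  define M1 where "M1 = M0(rOne := 1, rI := int n)"
  have "steps b 2 (Run 0 M0) (Run 2 M1)"
    using M0(1,3) big X_ge n_X by (simp add: exec_simps M1_def fits_X)
  then have r1: "reach b 2 (Run 0 M0) (Run 2 M1)" by (rule reach_steps) simp
  have in1: "input M1" using M0 by (auto simp: M1_def input_def)
  have M1': "M1 rI = int n" "M1 rCap = 0" "M1 rMax = 0" using M0(3) by (auto simp: M1_def)
  obtain M2 where M2: "reach b (9 * n + 1) (Run 2 M1) (Run 11 M2)" "input M2" "M2 rCap = int (\<Sum>k<n. w k)" "M2 rMax = int wm"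
     "\<And>a. 0 \<le> a \<or> a < - 8 \<Longrightarrow> M2 a = M1 a"
    using scan_loop[of n M1] in1 M1' by auto
  define M3 where "M3 = M2(rT := int (\<Sum>k<n. w k) - int W, rCap := min (int W) (int (\<Sum>k<n. w k)), rK := 1)"
  have M2_1: "M2 1 = int W" "M2 rM = 0" using M2(5)[of 1] M2(5)[of rM] M0 by (auto simp: M1_def)
  have "steps b (if int (\<Sum>k<n. w k) < int W then 3 else 4) (Run 11 M2) (Run 15 M3)" unfolding M3_def
    by (rule exec_clamp) (use M2(2,3) M2_1 big X_ge W_X w_X in \<open>auto simp: input_def simp del: of_nat_sum intro!: fits_X\<close>)
  then have r3: "reach b 4 (Run 11 M2) (Run 15 M3)" by (rule reach_steps) simp
  have in3: "input M3" using M2(2) by (auto simp: M3_def input_def)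
  have M3': "M3 rK = 1" "M3 rM = 0" using M2_1 by (auto simp: M3_def)
  obtain M4 where M4: "reach b (6 * m + 4) (Run 15 M3) (Run 22 M4)" "input M4" "M4 rK = int K" "M4 rM = int m"
     "\<And>a. a \<notin> {rT, rK, rM} \<Longrightarrow> M4 a = M3 a"
    using double_loop[of 0 M3] in3 M3' by auto
  have M4': "M4 rCap = int cap" "M4 rMax = int wm"
    using M4(5)[of rCap] M4(5)[of rMax] M2 by (auto simp: M3_def cap_def of_nat_min)
  define M5 where "M5 = M4(rT := 4, rDev := int K * int wm * (int m + 1) * 4, rBase := int n + int n + 1 + 1, rKeys := - 40, rI := int n)"
  have dev: "int K * int wm * (int m + 1) * 4 = int dev" by (simp add: dev_def algebra_simps)
  have "int K * int wm \<le> int K * int wm * (int m + 1)" by (simp add: algebra_simps)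
  moreover have "0 \<le> int K * int wm" by simp
  ultimately have d2: "int K * int wm \<le> 1000 * X" "int K * int wm * (int m + 1) \<le> 1000 * X" using dev dev_X X_ge by linarith+
  have "steps b 10 (Run 22 M4) (Run 32 M5)" unfolding M5_def
    by (rule exec_setup)
      (use M4(2-4) M4' big X_ge n_X dev d2 dev_X m_less_K K_X in \<open>auto simp: input_def intro!: fits_X\<close>)
  then have r5: "reach b 10 (Run 22 M4) (Run 32 M5)" by (rule reach_steps) simp
  have "reach b (9 * n + 6 * m + 21) (Run 0 M0) (Run 32 M5)"
    by (rule reach_mono[OF reach_trans[OF r1 reach_trans[OF M2(1) reach_trans[OF r3 reach_trans[OF M4(1) r5]]]]]) simp
  moreover have "regs M5" using M4(2-4) M4' dev by (auto simp: M5_def regs_def input_def)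
  moreover have "M5 rQ = 0" using M4(5)[of rQ] M2(5)[of rQ] M0(3) by (simp add: M5_def M3_def M1_def)
  moreover have "table (\<lambda>_. 0) M5" unfolding table_def
  proof
    fix j
    let ?a = "2 * int n + 2 + int j"
    show "M5 ?a = int 0" using M4(5)[of ?a] M2(5)[of ?a] M0(4)[of ?a] by (simp add: M5_def M3_def M1_def)
  qed
  ultimately show ?thesis unfolding M0_def by (intro exI[of _ M5]) (auto simp: M5_def)
qed

section \<open>The whole run and its length\<close>

text \<open>\<open>s\<close> precedes \<open>cs\<close>: for a given instance the coins of the keys
  sit at a fixed place. Surplus coins do no harm since \<open>Done\<close> is stable.\<close>

lemma run_prog:
  "\<exists>s \<le> 9 * n + 6 * m + 21. \<forall>cs. s + (n * (6 * m + 8) + 1) + (16 * K + 8 * n * K + n * (13 * width + 10) + 5) \<le> length cs \<longrightarrow>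
    exec prog b W items cs = Done (int (dp (keys m n (take (n * (6 * m + 8)) (drop s cs))) K cap))"
proof -
  let ?l = "n * (6 * m + 8)" and ?d = "16 * K + 8 * n * K + n * (13 * width + 10) + 5"
  obtain M s where s: "s \<le> 9 * n + 6 * m + 21" "steps b s (Run 0 (init_mem W items)) (Run 32 M)"
    and M: "regs M" "M rI = int n" "M rQ = 0" "table (\<lambda>_. 0) M"
    using prologue unfolding reach_def by blast
  have "exec prog b W items cs = Done (int (dp (keys m n (take ?l (drop s cs))) K cap))"
    if len: "s + (?l + 1) + ?d \<le> length cs" for cs
  proof -
    define y where "y = take (?l + 1) (drop s cs)"
    have y: "length y = ?l + 1" using len by (simp add: y_def)
    define key where "key = keys m n (take ?l (drop s cs))"
    have key_y: "keys m n y = key"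
      using keys_take[of m n y] by (simp add: y_def key_def min_def)
    obtain M' where M': "foldl (step prog b) (Run 32 M) y = Run 45 M'" "regs M'" "\<forall>k<n. M' (- 41 - int k) = int (keys m n y k)"
      "\<forall>a. 0 \<le> a \<or> a = rQ \<or> a \<le> - 41 - int n \<longrightarrow> M' a = M a"
      using key_loop[OF le_refl M(1,2) y] by blast
    have "stored key M'" "table (\<lambda>_. 0) M'" "M' rQ = 0" using M'(3,4) M(3,4) by (auto simp: stored_def table_def key_y)
    moreover have "key i < K" for i by (simp add: key_def K_def keys_less)
    ultimately obtain t where t: "t \<le> ?d" "steps b t (Run 45 M') (Done (int (dp key K cap)))"
      using run_dp[of key M'] M'(2) unfolding reach_def by blast
    define z where "z = drop (?l + 1) (drop s cs)"
    have done_stable: "foldl (step prog b) (Done v) xs = Done v" for v xs by (induction xs) auto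
    have "length (take t z) = t" using len t(1) by (simp add: z_def)
    then have "foldl (step prog b) (Run 45 M') (take t z) = Done (int (dp key K cap))" using t(2) by (simp add: steps_def)
    then have "foldl (step prog b) (Run 45 M') z = Done (int (dp key K cap))"
      using foldl_append[of "step prog b" "Run 45 M'" "take t z" "drop t z"] by (simp add: done_stable)
    moreover have "foldl (step prog b) (Run 0 (init_mem W items)) (take s cs) = Run 32 M" using s(2) len by (simp add: steps_def)
    moreover have "cs = take s cs @ y @ z" unfolding y_def z_def by (simp only: append_take_drop_id)
    ultimately show ?thesis unfolding exec_def key_def[symmetric]
      using foldl_append[of "step prog b" "Run 0 (init_mem W items)" "take s cs" "y @ z"] foldl_append[of "step prog b" "Run 32 M" y z] M'(1)
      by simp
  qed
  then show ?thesis using s(1) by blast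
qed

text \<open>Everything is measured in \<open>Q = wm * K * (m + 1)\<close>. As \<open>cap\<close> is
  at most \<open>n * wm\<close>, hence at most \<open>K^2 * wm\<close>, the drift
  \<open>cap div K\<close> is at most \<open>Q\<close>; with \<open>dev = 4 * Q\<close> this gives
  \<open>width\<close> at most \<open>12 * Q\<close>. Each summand is a multiple of
  \<open>n * Q\<close>, and 246 is the sum of the coefficients, 156 of them for the windows.\<close>

lemma time_bound:
  assumes "s \<le> 9 * n + 6 * m + 21"
  shows "s + (n * (6 * m + 8) + 1) + (16 * K + 8 * n * K + n * (13 * width + 10) + 5) \<le> 246 * (n * (wm * K * (m + 1)))"
proof -
  define Q where "Q = wm * K * (m + 1)"
  have Q: "wm * K \<le> Q" by (simp add: Q_def)
  have "wm \<le> wm * K" "K \<le> wm * K" using K_pos wm_pos by auto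
  then have Q1: "wm \<le> Q" "K \<le> Q" using Q by linarith+
  have "1 * (m + 1) \<le> wm * K * (m + 1)" using K_pos wm_pos by (intro mult_right_mono) auto
  then have Q2: "m \<le> Q" "1 \<le> Q" by (auto simp: Q_def)
  have "cap \<le> (\<Sum>i<n. w i)" by (simp add: cap_def)
  also have "\<dots> \<le> (\<Sum>i<n. wm)" using w_le_wm by (intro sum_mono) auto
  also have "\<dots> \<le> K\<^sup>2 * wm" using n_le_K by simp
  also have "\<dots> = (wm * K) * K" by (simp add: power2_eq_square)
  finally have "cap div K \<le> (wm * K) * K div K" by (rule div_le_mono)
  then have "cap div K \<le> Q" using Q K_pos by simp
  moreover have "dev = 4 * Q" by (simp add: dev_def Q_def)
  ultimately have width: "width \<le> 12 * Q" using Q1 Q2 unfolding width_def by linarith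
  have nQ: "n \<le> n * Q" "Q \<le> n * Q" using Q2 n_pos by auto
  have "n * m \<le> n * Q" "n * K \<le> n * Q" "n * width \<le> n * (12 * Q)" using Q1 Q2 width by (auto intro: mult_left_mono)
  moreover have "n * (6 * m + 8) = 6 * (n * m) + 8 * n" "8 * n * K = 8 * (n * K)"
    "n * (13 * width + 10) = 13 * (n * width) + 10 * n" "n * (12 * Q) = 12 * (n * Q)" by (simp_all add: algebra_simps)
  ultimately show ?thesis using assms nQ Q1 Q2 unfolding Q_def[symmetric] by linarith
qed

end

section \<open>Time bound, word size and success probability\<close>

context knapsack
begin

text \<open>\<open>4 ^ m \<le> 4 * n\<close> and \<open>1 \<le> ln 4\<close> give
  \<open>m - 1 \<le> ln n\<close>; the missing 2 is at most twice the logarithm on the right, whose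
  argument is at least 4.\<close>

lemma m_le_ln: "real (m + 1) \<le> 3 * ln (real (n + wm) + 2)"
proof -
  have e: "1 \<le> ln (4 :: real)" using exp_le by (subst ln_ge_iff) auto
  have n1: "real n \<ge> 1" using n_pos by simp
  have L: "ln 4 \<le> ln (real (n + wm) + 2)" "ln (real n) \<le> ln (real (n + wm) + 2)" using n_pos wm_pos by auto
  have "real (4 ^ m) \<le> real (4 * n)" using K_le_n unfolding K_def of_nat_le_iff by (simp add: power2_eq_square flip: power_mult_distrib)
  then have "ln (4 ^ m :: real) \<le> ln (4 * real n)" using n1 by (subst ln_le_cancel_iff) auto
  then have "real m * ln 4 \<le> ln 4 + ln (real n)" using n1 by (simp add: ln_realpow ln_mult)
  then have "(real m - 1) * ln 4 \<le> ln (real n)" by (simp add: algebra_simps)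
  moreover have "real m - 1 \<le> (real m - 1) * ln 4 \<or> m = 0" using e mult_left_mono[of 1 "ln 4" "real m - 1"] by (cases m) auto
  moreover have "0 \<le> ln (real n)" using n1 by simp
  ultimately have "real m - 1 \<le> ln (real n)" by auto
  then show ?thesis using L e unfolding of_nat_add[of m] of_nat_1 by linarith
qed

lemma K_le_sqrt: "real K \<le> 2 * sqrt (real n)"
proof -
  have "(real K)\<^sup>2 \<le> (2 * sqrt (real n))\<^sup>2"
    using K_le_n by (simp add: power_mult_distrib flip: of_nat_power of_nat_le_iff[where 'a = real])
  then show ?thesis by (rule power2_le_imp_le) simp
qed

text \<open>The factors 2 from \<open>K_le_sqrt\<close> and 3 from \<open>m_le_ln\<close> turn 246
  into 1476, rounded up to 1500.\<close>

lemma steps_le_time: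
  "246 * (n * (wm * K * (m + 1))) \<le> nat \<lceil>1500 * real n powr (3/2) * real wm * ln (real (n + wm) + 2) ^ 1\<rceil>"
proof -
  have "real (K * (m + 1)) \<le> (2 * sqrt (real n)) * (3 * ln (real (n + wm) + 2))"
    unfolding of_nat_mult by (intro mult_mono K_le_sqrt m_le_ln) auto
  then have "246 * (real n * real wm) * real (K * (m + 1)) \<le> 246 * (real n * real wm) * ((2 * sqrt (real n)) * (3 * ln (real (n + wm) + 2)))"
    by (intro mult_left_mono) auto
  also have "\<dots> = 1476 * (real n * sqrt (real n)) * real wm * ln (real (n + wm) + 2)" by (simp add: algebra_simps)
  also have "real n * sqrt (real n) = real n powr (3/2)"
    using powr_add[of "real n" 1 "1/2"] n_pos by (simp add: powr_half_sqrt)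
  also have "1476 * real n powr (3/2) * real wm * ln (real (n + wm) + 2) \<le> 1500 * real n powr (3/2) * real wm * ln (real (n + wm) + 2)"
    by (intro mult_right_mono) auto
  finally have "real (246 * (n * (wm * K * (m + 1)))) \<le> 1500 * real n powr (3/2) * real wm * ln (real (n + wm) + 2) ^ 1"
    by (simp add: algebra_simps)
  then show ?thesis by linarith
qed

text \<open>The number whose logarithm \<open>word_size\<close> takes.\<close>

definition N :: nat where
  "N = n + W + (\<Sum>i<n. w i) + (\<Sum>i<n. p i) + 2"

lemma N_pow_le: "int N ^ 8 \<le> 2 ^ word_size 8 W items"
proof -
  have "(\<Sum>(w, p)\<leftarrow>items. w + p) = (\<Sum>i<n. w i + p i)"
    by (simp add: sum_list_sum_nth atLeast0LessThan n_def w_def p_def case_prod_beta)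
  then have ws: "word_size 8 W items = 8 * nat \<lceil>log 2 (real N)\<rceil>"
    by (simp add: word_size_def N_def n_def sum.distrib add.assoc)
  have "N > 0" by (simp add: N_def)
  then have "real N = 2 powr log 2 (real N)" by simp
  also have "\<dots> \<le> 2 powr real (nat \<lceil>log 2 (real N)\<rceil>)" by (intro powr_mono) (auto simp: real_nat_ceiling_ge)
  also have "\<dots> = real (2 ^ nat \<lceil>log 2 (real N)\<rceil>)" by (simp add: powr_realpow)
  finally have "N \<le> 2 ^ nat \<lceil>log 2 (real N)\<rceil>" by (simp only: of_nat_le_iff)
  then have "N ^ 8 \<le> (2 ^ nat \<lceil>log 2 (real N)\<rceil>) ^ 8" by (rule power_mono) simp
  then have "int (N ^ 8) \<le> int ((2 ^ nat \<lceil>log 2 (real N)\<rceil>) ^ 8)" by (simp only: of_nat_le_iff)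
  then show ?thesis unfolding ws by (simp add: mult.commute flip: power_mult)
qed

text \<open>The cube is needed for \<open>dev\<close>, a product of \<open>wm\<close>,
  \<open>K\<close> and \<open>m + 1\<close>, each at most \<open>2 * N\<close>. The word size factor
  8 leaves \<open>N ^ 5\<close> to exceed 1000, which follows from \<open>6 \<le> N\<close>.\<close>

lemma ram: "knapsack_ram W items (word_size 8 W items) (int N ^ 3)"
proof -
  have N6: "6 \<le> N"
  proof -
    have "w 0 \<le> (\<Sum>i<n. w i)" "p 0 \<le> (\<Sum>i<n. p i)" using n_pos by (auto intro!: member_le_sum)
    moreover have "W > 0" using valid by (simp add: valid_instance_def)
    ultimately show ?thesis using w_pos[of 0] p_pos[of 0] n_pos by (simp add: N_def)
  qed
  have "6 * N \<le> N * N" "6 * (N * N) \<le> N * (N * N)" using N6 by simp_all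
  moreover have "N ^ 3 = N * (N * N)" "2 * N * N = 2 * (N * N)" by (simp_all add: power3_eq_cube)
  ultimately have N3: "N \<le> N ^ 3" "2 * N \<le> N ^ 3" "2 * N * N \<le> N ^ 3" by linarith+
  have nN: "n \<le> N" "W \<le> N" "(\<Sum>i<n. w i) \<le> N" "(\<Sum>i<n. p i) \<le> N" "cap \<le> N" by (auto simp: N_def cap_def)
  have wmN: "wm \<le> N" using wm_le_sum nN(3) by linarith
  have "n * 1 \<le> n * n" using n_pos by (intro mult_le_mono2) simp
  moreover have "(2 * n)\<^sup>2 = 4 * (n * n)" by (simp add: power2_eq_square)
  ultimately have "K\<^sup>2 \<le> (2 * n)\<^sup>2" using K_le_n by linarith
  then have KN: "K \<le> 2 * N" using nN(1) power2_le_imp_le[of K "2 * n"] by linarith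
  have mK: "m + 1 \<le> K" unfolding K_def using less_exp[of m] by (simp add: Suc_le_eq)
  have Kc: "K * cap \<le> N ^ 3" using mult_le_mono[OF KN nN(5)] N3(3) by linarith
  have "dev \<le> 4 * N * (2 * N) * (2 * N)" unfolding dev_def using wmN KN mK by (intro mult_le_mono) auto
  then have dv: "dev \<le> 16 * N ^ 3" by (simp add: power3_eq_cube)
  have big: "1000 * N ^ 3 < N ^ 8"
  proof -
    have "(6 :: nat) ^ 5 \<le> N ^ 5" using N6 by (intro power_mono) auto
    then have "1000 < N ^ 5" by simp
    then have "1000 * N ^ 3 < N ^ 5 * N ^ 3" using N6 by (intro mult_strict_right_mono) auto
    then show ?thesis by (simp flip: power_add)
  qed
  have N40: "40 \<le> N ^ 3" using power_mono[OF N6, of 3] by simp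
  have KK: "K * K \<le> 4 * N ^ 3" using K_le_n nN(1) N3(1) by (simp add: power2_eq_square)
  have i: "int a \<le> int N ^ 3" if "a \<le> N ^ 3" for a using that by (metis of_nat_le_iff of_nat_power)
  show ?thesis
  proof (unfold_locales)
    show "40 \<le> int N ^ 3" using i[OF N40] by simp
    have "int (1000 * N ^ 3) < int (N ^ 8)" using big by (simp only: of_nat_less_iff)
    then show "1000 * int N ^ 3 < 2 ^ word_size 8 W items" using N_pow_le by simp
    show "int n \<le> int N ^ 3" "int W \<le> int N ^ 3" "int (\<Sum>i<n. w i) \<le> int N ^ 3" "int (\<Sum>i<n. p i) \<le> int N ^ 3" "int K \<le> int N ^ 3"
      using nN N3 KN by (intro i; linarith)+
    show "int K * int cap \<le> int N ^ 3" using i[OF Kc] by simp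
    have "int (K * K) \<le> int (4 * N ^ 3)" using KK by (simp only: of_nat_le_iff)
    then show "int K * int K \<le> 4 * int N ^ 3" by simp
    have "int dev \<le> int (16 * N ^ 3)" using dv by (simp only: of_nat_le_iff)
    then show "int dev \<le> 16 * int N ^ 3" by simp
  qed
qed

lemma correct_whp:
  assumes T: "246 * (n * (wm * K * (m + 1))) \<le> T"
  defines "b \<equiv> word_size 8 W items"
  shows "\<forall>cs. length cs = T \<longrightarrow> (\<exists>v. exec prog b W items cs = Done v)"
    and "(1 - 1 / real (n + 1)) * 2 ^ T \<le>
      real (card {cs. length cs = T \<and> exec prog b W items cs = Done (int (knapsack_opt W items))})"
proof -
  interpret knapsack_ram W items b "int N ^ 3" unfolding b_def by (rule ram)
  let ?l = "n * (6 * m + 8)"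
  obtain s where s: "s \<le> 9 * n + 6 * m + 21"
    and run: "\<And>cs. s + (?l + 1) + (16 * K + 8 * n * K + n * (13 * width + 10) + 5) \<le> length cs \<Longrightarrow>
      exec prog b W items cs = Done (int (dp (keys m n (take ?l (drop s cs))) K cap))"
    using run_prog by blast
  have le: "s + (?l + 1) + (16 * K + 8 * n * K + n * (13 * width + 10) + 5) \<le> T" using time_bound[OF s] T by linarith
  show "\<forall>cs. length cs = T \<longrightarrow> (\<exists>v. exec prog b W items cs = Done v)" using run le by blast
  define r where "r = T - s - ?l"
  have T: "T = s + (?l + r)" using le by (simp add: r_def)
  \<comment> \<open>The optimal set is fixed before the coins are drawn, so concentration for this
    single set is enough and no union over sets arises.\<close>
  obtain S where S: "S \<subseteq> {..<n}" "sum w S \<le> cap" "sum p S = knapsack_opt W items" "cap - sum w S < wm"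
    using optimal_subset by blast
  define bad where "bad = {cs. length cs = T \<and> \<not> good S (keys m n (take ?l (drop s cs)))}"
  let ?ok = "{cs. length cs = T \<and> exec prog b W items cs = Done (int (knapsack_opt W items))}"
  have "card bad = 2 ^ s * (card {cs. length cs = ?l \<and> \<not> good S (keys m n cs)} * 2 ^ r)"
    unfolding bad_def T by (rule card_coins_middle)
  then have "real (card bad) = 2 ^ s * (real (card {cs. length cs = ?l \<and> \<not> good S (keys m n cs)}) * 2 ^ r)" by simp
  also have "\<dots> \<le> 2 ^ s * (2 ^ ?l / real (n + 1) * 2 ^ r)"
    by (intro mult_left_mono mult_right_mono card_bad_le S) auto
  also have "\<dots> = 2 ^ T / real (n + 1)" unfolding T by (simp add: power_add)
  finally have bad: "real (card bad) \<le> 2 ^ T / real (n + 1)" .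
  have "{cs. length cs = T} \<subseteq> ?ok \<union> bad"
    using run le dp_eq_opt[OF S(1-3)] keys_less by (auto simp: bad_def K_def)
  then have "card {cs :: bool list. length cs = T} \<le> card (?ok \<union> bad)"
    by (intro card_mono) (auto simp: bad_def intro: finite_subset[OF _ finite_coins[of T]])
  also have "\<dots> \<le> card ?ok + card bad" by (rule card_Un_le)
  finally have "2 ^ T \<le> card ?ok + card bad" by (simp add: card_coins)
  then have "real (2 ^ T) \<le> real (card ?ok + card bad)" by (simp only: of_nat_le_iff)
  then have "2 ^ T \<le> real (card ?ok) + real (card bad)" by simp
  then show "(1 - 1 / real (n + 1)) * 2 ^ T \<le> real (card ?ok)" using bad by (simp add: algebra_simps)
qed

end

theorem theorem1:
  shows "\<exists>(P :: instr list) (cw :: nat) (ct :: real) (k :: nat) (d :: nat).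
     cw \<ge> 1 \<and> ct > 0 \<and> d \<ge> 1 \<and>
     (\<forall>W items. valid_instance W items \<longrightarrow>
        (let n = length items;
             T = nat \<lceil>ct * real n powr (3/2) * real (wmax items)
                       * (ln (real (n + wmax items) + 2)) ^ k\<rceil>;
             b = word_size cw W items
         in (\<forall>cs. length cs = T \<longrightarrow> (\<exists>v. exec P b W items cs = Done v)) \<and>
            real (card {cs :: bool list. length cs = T \<and>
                          exec P b W items cs = Done (int (knapsack_opt W items))})
              \<ge> (1 - 1 / real (n + 1) ^ d) * 2 ^ T))"
proof (rule exI[of _ prog], rule exI[of _ 8], rule exI[of _ 1500], rule exI[of _ 1], rule exI[of _ 1],
    intro conjI allI impI)
  fix W :: nat and items :: "(nat \<times> nat) list"
  assume "valid_instance W items"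
  then interpret knapsack W items by unfold_locales
  show "let n = length items;
             T = nat \<lceil>1500 * real n powr (3/2) * real (wmax items)
                       * (ln (real (n + wmax items) + 2)) ^ 1\<rceil>;
             b = word_size 8 W items
         in (\<forall>cs. length cs = T \<longrightarrow> (\<exists>v. exec prog b W items cs = Done v)) \<and>
            real (card {cs :: bool list. length cs = T \<and>
                          exec prog b W items cs = Done (int (knapsack_opt W items))})
              \<ge> (1 - 1 / real (n + 1) ^ 1) * 2 ^ T"
    using correct_whp[OF steps_le_time] unfolding Let_def n_def[symmetric] wm_def[symmetric] by simp
qed simp_all

end
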